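(* Let $\delta>0$ and let $\omega=(q_n)_{n=1}^{\infty}$ and $\widetilde\omega=(\tilde q_n)_{n=1}^{\infty}$ be sequences of real numbers in $(0,1)$ with $\delta$-lower bound, i.e. $q_n\ge\delta$ and $\tilde q_n\ge\delta$ for all $n\in\mathbb N$. Put $$d(\omega,\widetilde\omega)=\sup_{n\in\mathbb N}\max\left\{\left|\log\frac{1-\tilde q_n}{1-q_n}\right|,\ |\tilde q_n-q_n|\right\}.$$ Let $E(\omega)$, $E(\widetilde\omega)$ be the associated random Cantor sets. (1) If $d(\omega,\widetilde\omega)<\infty$, then there exists an $\exp(C(\delta)\,d(\omega,\widetilde\omega))$-quasiconformal mapping $\varphi$ of $\widehat{\mathbb C}$ onto itself such that $\varphi(E(\omega))=E(\widetilde\omega)$, where $C(\delta)>0$ is a constant depending only on $\delta$. (2) If $\lim_{n\to\infty}\log\frac{1-\tilde q_n}{1-q_n}=0$, then $E(\widetilde\omega)$ is asymptotically conformal to $E(\omega)$; that is, there exists a quasiconformal mapping $\varphi$ of $\widehat{\mathbb C}$ onto itself with $\varphi(E(\omega))=E(\widetilde\omega)$ such that for every $\varepsilon>0$ there is a neighborhood $U_\varepsilon$ of $E(\omega)$ on which $\varphi|_{U_\varepsilon}$ is $(1+\varepsilon)$-quasiconformal.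
   Context: Random Cantor set $E(\omega)$: for a sequence $\omega=(q_n)_{n\ge1}$ with $0<q_n<1$, put $E_0=[0,1]$. Inductively, $E_k$ is a disjoint union of $2^k$ closed intervals of equal length, and $E_{k+1}$ is obtained from $E_k$ by removing from each of these closed intervals $I$ the concentric open interval of length $q_{k+1}|I|$, where $|I|$ is the length of $I$ (so that two closed intervals of equal length remain in $I$). Then $E(\omega)=\bigcap_{k\ge1}E_k$. (Despite the name, the construction is deterministic.) *)

theory Defs
  imports "HOL-Analysis.Analysis"
begin

section \<open>Cantor sets with variable ratios\<close>

text \<open>
  Sequences \<open>q\<^sub>1, q\<^sub>2, \<dots>\<close> are functions \<open>nat \<Rightarrow> real\<close> of which only the values at indices
  \<open>n \<ge> 1\<close> are ever used. The pairs in \<open>cantor_intervals q k\<close> are the end points of the \<open>2^k\<close>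
  closed intervals of the \<open>k\<close>-th stage; that they arise by removing the concentric open interval
  \<open>middle_gap\<close> is \<open>interval_minus_middle_gap\<close> below.
\<close>

definition ratio_seq :: "real \<Rightarrow> (nat \<Rightarrow> real) \<Rightarrow> bool" where
  "ratio_seq \<delta> q \<longleftrightarrow> (\<forall>n\<ge>1. 0 < q n \<and> q n < 1 \<and> \<delta> \<le> q n)"

definition middle_gap :: "real \<Rightarrow> real \<Rightarrow> real \<Rightarrow> real set" where
  "middle_gap r a b = {(a + b)/2 - r * (b - a)/2 <..< (a + b)/2 + r * (b - a)/2}"

fun cantor_intervals :: "(nat \<Rightarrow> real) \<Rightarrow> nat \<Rightarrow> (real \<times> real) set" where
  "cantor_intervals q 0 = {(0, 1)}"
| "cantor_intervals q (Suc k) =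
     (\<Union>(a, b) \<in> cantor_intervals q k.
        {(a, (a + b)/2 - q (Suc k) * (b - a)/2), ((a + b)/2 + q (Suc k) * (b - a)/2, b)})"

definition cantor_stage :: "(nat \<Rightarrow> real) \<Rightarrow> nat \<Rightarrow> real set" where
  "cantor_stage q k = (\<Union>(a, b) \<in> cantor_intervals q k. {a..b})"

definition cantor_set :: "(nat \<Rightarrow> real) \<Rightarrow> real set" where
  "cantor_set q = (\<Inter>k\<in>{1..}. cantor_stage q k)"

lemma interval_minus_middle_gap:
  assumes "a \<le> b" "0 < r" "r < 1"
  shows "{a..b} - middle_gap r a b =
         {a..(a + b)/2 - r * (b - a)/2} \<union> {(a + b)/2 + r * (b - a)/2..b}"
proof -
  have "r * (b - a) \<le> 1 * (b - a)" "0 \<le> r * (b - a)"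
    using assms by (intro mult_right_mono mult_nonneg_nonneg; simp)+
  then show ?thesis
    by (auto simp: middle_gap_def field_simps)
qed

definition ratio_dist :: "(nat \<Rightarrow> real) \<Rightarrow> (nat \<Rightarrow> real) \<Rightarrow> ereal" where
  "ratio_dist q q' =
     (SUP n\<in>{1..}. ereal (max \<bar>ln ((1 - q' n) / (1 - q n))\<bar> \<bar>q' n - q n\<bar>))"

section \<open>Quasiconformal maps between plane open sets\<close>

definition absolutely_continuous_segment :: "real \<Rightarrow> real \<Rightarrow> (real \<Rightarrow> complex) \<Rightarrow> bool" where
  "absolutely_continuous_segment a b f \<longleftrightarrow>
     (\<forall>\<epsilon>>0. \<exists>\<eta>>0. \<forall>P :: (real \<times> real) set.
        finite P \<longrightarrow> (\<forall>(s, t)\<in>P. a \<le> s \<and> s \<le> t \<and> t \<le> b) \<longrightarrow>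
        disjoint_family_on (\<lambda>(s, t). {s<..<t}) P \<longrightarrow>
        (\<Sum>(s, t)\<in>P. t - s) < \<eta> \<longrightarrow> (\<Sum>(s, t)\<in>P. cmod (f t - f s)) < \<epsilon>)"

definition ACL_on :: "complex set \<Rightarrow> (complex \<Rightarrow> complex) \<Rightarrow> bool" where
  "ACL_on D f \<longleftrightarrow>
     (\<forall>a b c d. cbox (Complex a c) (Complex b d) \<subseteq> D \<longrightarrow>
        (AE y in lborel. c \<le> y \<and> y \<le> d \<longrightarrow> absolutely_continuous_segment a b (\<lambda>x. f (Complex x y))) \<and>
        (AE x in lborel. a \<le> x \<and> x \<le> b \<longrightarrow> absolutely_continuous_segment c d (\<lambda>y. f (Complex x y))))"

text \<open>
  With \<open>u = f\<^sub>x(z)\<close> and \<open>v = f\<^sub>y(z)\<close>, the complex derivatives are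
  \<open>f\<^sub>z = (u - \<i> v)/2\<close> and \<open>f\<^sub>z\<^sub>b\<^sub>a\<^sub>r = (u + \<i> v)/2\<close>.
\<close>

definition dilatation_le_at :: "real \<Rightarrow> (complex \<Rightarrow> complex) \<Rightarrow> complex \<Rightarrow> bool" where
  "dilatation_le_at K f z \<longleftrightarrow>
     (\<exists>u v. ((\<lambda>x. f (Complex x (Im z))) has_vector_derivative u) (at (Re z)) \<and>
            ((\<lambda>y. f (Complex (Re z) y)) has_vector_derivative v) (at (Im z)) \<and>
            cmod ((u + \<i> * v) / 2) \<le> (K - 1) / (K + 1) * cmod ((u - \<i> * v) / 2))"

text \<open>
  The analytic definition. Preservation of orientation need not be required separately: the
  dilatation inequality forces the Jacobian to be nonnegative almost everywhere.
\<close>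

definition plane_quasiconformal_on :: "real \<Rightarrow> complex set \<Rightarrow> (complex \<Rightarrow> complex) \<Rightarrow> bool" where
  "plane_quasiconformal_on K D f \<longleftrightarrow>
     1 \<le> K \<and> open D \<and> (\<exists>g. homeomorphism D (f ` D) f g) \<and>
     ACL_on D f \<and> (AE z in lborel. z \<in> D \<longrightarrow> dilatation_le_at K f z)"

section \<open>Quasiconformal maps on the Riemann sphere\<close>

text \<open>
  The sphere is the one-point compactification of the plane, with \<open>None\<close> as the point at infinity.
  Its two standard charts are \<open>z\<close> (used at finite points) and \<open>1/z\<close> (used at infinity);
  \<open>sphere_chart p\<close> is the one chosen at \<open>p\<close>, and \<open>sphere_param p\<close> is its inverse.
  The value of the chart \<open>z\<close> at infinity and that of the chart \<open>1/z\<close> at the origin are irrelevant.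
\<close>

abbreviation riemann_sphere :: "complex option topology" where
  "riemann_sphere \<equiv> Alexandroff_compactification euclidean"

definition sphere_chart_dom :: "complex option \<Rightarrow> complex option set" where
  "sphere_chart_dom p = (if p = None then - {Some 0} else - {None})"

definition sphere_chart :: "complex option \<Rightarrow> complex option \<Rightarrow> complex" where
  "sphere_chart p w = (case w of None \<Rightarrow> 0 | Some z \<Rightarrow> if p = None then 1 / z else z)"

definition sphere_param :: "complex option \<Rightarrow> complex \<Rightarrow> complex option" where
  "sphere_param p z = (if p = None then (if z = 0 then None else Some (1 / z)) else Some z)"

text \<open>
  A homeomorphism of an open subset of the sphere onto its image is quasiconformal if it is so
  near each point in terms of the charts chosen at that point and at its image.
\<close>

definition quasiconformal_on ::
    "real \<Rightarrow> complex option set \<Rightarrow> (complex option \<Rightarrow> complex option) \<Rightarrow> bool" where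
  "quasiconformal_on K U \<phi> \<longleftrightarrow>
     openin riemann_sphere U \<and>
     embedding_map (subtopology riemann_sphere U) riemann_sphere \<phi> \<and>
     (\<forall>p\<in>U. \<exists>D. sphere_chart p p \<in> D \<and> sphere_param p ` D \<subseteq> U \<and>
        \<phi> ` sphere_param p ` D \<subseteq> sphere_chart_dom (\<phi> p) \<and>
        plane_quasiconformal_on K D (sphere_chart (\<phi> p) \<circ> \<phi> \<circ> sphere_param p))"

definition quasiconformal_sphere :: "real \<Rightarrow> (complex option \<Rightarrow> complex option) \<Rightarrow> bool" where
  "quasiconformal_sphere K \<phi> \<longleftrightarrow>
     homeomorphic_map riemann_sphere riemann_sphere \<phi> \<and> quasiconformal_on K UNIV \<phi>"

definition asymptotically_conformal_to :: "complex option set \<Rightarrow> complex option set \<Rightarrow> bool" where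
  "asymptotically_conformal_to E' E \<longleftrightarrow>
     (\<exists>K \<phi>. quasiconformal_sphere K \<phi> \<and> \<phi> ` E = E' \<and>
        (\<forall>\<epsilon>>0. \<exists>U. openin riemann_sphere U \<and> E \<subseteq> U \<and> quasiconformal_on (1 + \<epsilon>) U \<phi>))"

definition sphere_cantor_set :: "(nat \<Rightarrow> real) \<Rightarrow> complex option set" where
  "sphere_cantor_set q = (\<lambda>x. Some (complex_of_real x)) ` cantor_set q"

end

theory Submission
  imports Defs
begin

text \<open>
  The homeomorphism of the plane is built by self-similarity.  Put \<open>b = (1 - q\<^sub>1)/2\<close>,
  \<open>b' = (1 - q'\<^sub>1)/2\<close>.  The left child interval \<open>[0, b]\<close> of \<open>[0, 1]\<close> lies in the elliptic disc with
  foci \<open>0\<close> and \<open>b\<close>, which belongs to a family of ellipses homothetic about the end point \<open>0\<close>;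
  because \<open>q\<^sub>1 \<ge> \<delta>\<close>, the ring between this disc and the largest member of the family in
  \<open>Re z \<le> 1/2\<close> has modulus bounded below in terms of \<open>\<delta>\<close>.  The map is a power stretch along the rays
  from \<open>0\<close> on that ring, the rescaled map of the shifted sequences inside it, the mirror image of
  this at the end point \<open>1\<close>, and the identity elsewhere.  Only the stretches contribute to the
  dilatation, each by at most \<open>exp (C \<bar>ln (b'/b)\<bar>)\<close>, so no distortion accumulates over the stages;
  near the Cantor set only late stages contribute.  Exchanging the two sequences inverts the map.
\<close>

section \<open>Plane maps\<close>

text \<open>The children \<open>[0, b]\<close> and \<open>[0, b']\<close> share the end point
  \<open>0\<close>, so passing from one to the other is a homothety about \<open>0\<close>. This is
  why the ellipses are homothetic about an end point and not concentric with the children. The disc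
  around \<open>[0, 1]\<close> should be symmetric under \<open>z \<mapsto> 1 - z\<close> and have a
  simple gauge about \<open>0\<close>. An ellipse with foci \<open>0\<close> and \<open>1\<close>
  offers both: the sum of distances is symmetric, and the gauge about a focus is linear in
  \<open>cmod z\<close> and \<open>Re z\<close>, the polar equation of a conic. The price is that
  the rays cross the ellipses obliquely. The obstacle lies in the limit: the Lipschitz constants at
  hand for the finite approximations depend on the depth. The inequality
  \<open>2 * b n \<le> 1 - \<delta>\<close> helps twice. For the target sequence it makes the
  approximations converge uniformly. For the source sequence it makes the nested elliptic regions
  meet the real axis in a set of length zero. Off the intersection of these regions the limit is
  locally a finite approximation, and almost every horizontal or vertical line avoids that
  intersection.\<close>

lemma AE_lborel_iff_negligible:
  "(AE z in lborel. P z) \<longleftrightarrow> negligible {z :: complex. \<not> P z}"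
proof -
  \<comment> \<open>An AE statement asks only for a null superset of the exceptional set, so
    completing the measure changes nothing, even for a nonmeasurable \<open>P\<close>.\<close>
  have "(AE z in lborel. P z) \<longleftrightarrow> (AE z in lebesgue. P z)"
    by (simp only: AE_completion_iff)
  also have "\<dots> \<longleftrightarrow> (\<exists>N. negligible N \<and> {z. \<not> P z} \<subseteq> N)"
    by (auto simp: eventually_ae_filter negligible_iff_null_sets)
  also have "\<dots> \<longleftrightarrow> negligible {z. \<not> P z}"
    using negligible_subset by blast
  finally show ?thesis .
qed

text \<open>Affine maps are differentiable and so preserve negligible sets. The cases of interest
  are the rescaling \<open>z / b\<close> and the reflection \<open>1 - z\<close>.\<close>

lemma AE_lborel_affine:
  fixes P :: "complex \<Rightarrow> bool"
  assumes "AE z in lborel. P z" "a \<noteq> 0"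
  shows "AE z in lborel. P (of_real a * z + d)"
proof -
  have "{z. \<not> P (of_real a * z + d)} = (\<lambda>w. (w - d) / of_real a) ` {z. \<not> P z}"
  proof (intro set_eqI iffI)
    fix z assume "z \<in> {z. \<not> P (of_real a * z + d)}"
    then show "z \<in> (\<lambda>w. (w - d) / of_real a) ` {z. \<not> P z}"
      using assms(2) by (intro image_eqI[of _ _ "of_real a * z + d"]) auto
  qed (use assms(2) in auto)
  moreover have "negligible ((\<lambda>w. (w - d) / of_real a) ` {z. \<not> P z})"
    using assms(1) unfolding AE_lborel_iff_negligible
    by (intro negligible_differentiable_image_negligible)
       (auto simp: divide_inverse intro!: linear_imp_differentiable_on differentiable_on_mult derivative_intros)
  ultimately show ?thesis
    by (simp add: AE_lborel_iff_negligible)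
qed

lemma AE_Im_nonzero: "AE z :: complex in lborel. Im z \<noteq> 0"
proof -
  have "negligible {z :: complex. \<i> \<bullet> z = 0}"
    by (rule negligible_hyperplane) auto
  then show ?thesis by (simp add: AE_lborel_iff_negligible inner_complex_def)
qed

lemma AE_Re_neq: "AE z :: complex in lborel. Re z \<noteq> c"
proof -
  have "negligible {z :: complex. 1 \<bullet> z = c}"
    by (rule negligible_hyperplane) auto
  then show ?thesis by (simp add: AE_lborel_iff_negligible inner_complex_def)
qed

lemma AE_lborel_neq: "AE y in lborel. y \<noteq> (c :: real)"
  using AE_lborel_singleton by auto

section \<open>Absolute continuity along segments and lines\<close>

lemma lipschitz_imp_absolutely_continuous:
  assumes "L-lipschitz_on {a..b} f"
  shows "absolutely_continuous_segment a b f"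
  unfolding absolutely_continuous_segment_def
proof (intro allI impI)
  fix \<epsilon> :: real assume "\<epsilon> > 0"
  have L: "0 \<le> L" using assms by (rule lipschitz_on_nonneg)
  show "\<exists>\<eta>>0. \<forall>P :: (real \<times> real) set.
        finite P \<longrightarrow> (\<forall>(s, t)\<in>P. a \<le> s \<and> s \<le> t \<and> t \<le> b) \<longrightarrow>
        disjoint_family_on (\<lambda>(s, t). {s<..<t}) P \<longrightarrow>
        (\<Sum>(s, t)\<in>P. t - s) < \<eta> \<longrightarrow> (\<Sum>(s, t)\<in>P. cmod (f t - f s)) < \<epsilon>"
  \<comment> \<open>The denominator \<open>L + 1\<close> also covers \<open>L = 0\<close>.\<close>
  proof (intro exI[of _ "\<epsilon> / (L + 1)"] conjI allI impI)
    show "0 < \<epsilon> / (L + 1)" using \<open>\<epsilon> > 0\<close> L by auto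
    fix P :: "(real \<times> real) set"
    assume P: "\<forall>(s, t)\<in>P. a \<le> s \<and> s \<le> t \<and> t \<le> b" and lt: "(\<Sum>(s, t)\<in>P. t - s) < \<epsilon> / (L + 1)"
    have nn: "0 \<le> (\<Sum>(s, t)\<in>P. t - s)" using P by (intro sum_nonneg) auto
    have "(\<Sum>(s, t)\<in>P. cmod (f t - f s)) \<le> (\<Sum>(s, t)\<in>P. L * (t - s))"
    proof (rule sum_mono, clarify)
      fix s t assume "(s, t) \<in> P"
      then have "a \<le> s" "s \<le> t" "t \<le> b" using P by auto
      then show "cmod (f t - f s) \<le> L * (t - s)"
        using lipschitz_on_normD[OF assms, of t s] by auto
    qed
    also have "\<dots> = L * (\<Sum>(s, t)\<in>P. t - s)"
      by (simp add: sum_distrib_left case_prod_beta)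
    also have "\<dots> \<le> (L + 1) * (\<Sum>(s, t)\<in>P. t - s)" using nn by (simp add: distrib_right)
    also have "\<dots> < \<epsilon>" using lt L by (simp add: field_simps)
    finally show "(\<Sum>(s, t)\<in>P. cmod (f t - f s)) < \<epsilon>" .
  qed
qed

lemma absolutely_continuous_segment_cong:
  assumes "absolutely_continuous_segment a b f" "\<And>x. a \<le> x \<Longrightarrow> x \<le> b \<Longrightarrow> f x = g x"
  shows "absolutely_continuous_segment a b g"
  unfolding absolutely_continuous_segment_def
proof (intro allI impI)
  fix \<epsilon> :: real assume "\<epsilon> > 0"
  then obtain \<eta> where \<eta>: "\<eta> > 0" "\<And>P :: (real \<times> real) set.
        finite P \<Longrightarrow> (\<forall>(s, t)\<in>P. a \<le> s \<and> s \<le> t \<and> t \<le> b) \<Longrightarrow>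
        disjoint_family_on (\<lambda>(s, t). {s<..<t}) P \<Longrightarrow>
        (\<Sum>(s, t)\<in>P. t - s) < \<eta> \<Longrightarrow> (\<Sum>(s, t)\<in>P. cmod (f t - f s)) < \<epsilon>"
    using assms(1) unfolding absolutely_continuous_segment_def by meson
  show "\<exists>\<eta>>0. \<forall>P :: (real \<times> real) set.
        finite P \<longrightarrow> (\<forall>(s, t)\<in>P. a \<le> s \<and> s \<le> t \<and> t \<le> b) \<longrightarrow>
        disjoint_family_on (\<lambda>(s, t). {s<..<t}) P \<longrightarrow>
        (\<Sum>(s, t)\<in>P. t - s) < \<eta> \<longrightarrow> (\<Sum>(s, t)\<in>P. cmod (g t - g s)) < \<epsilon>"
  proof (intro exI[of _ \<eta>] conjI allI impI \<eta>(1))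
    fix P :: "(real \<times> real) set"
    assume P: "finite P" "\<forall>(s, t)\<in>P. a \<le> s \<and> s \<le> t \<and> t \<le> b"
      "disjoint_family_on (\<lambda>(s, t). {s<..<t}) P" "(\<Sum>(s, t)\<in>P. t - s) < \<eta>"
    have "(\<Sum>(s, t)\<in>P. cmod (f t - f s)) = (\<Sum>(s, t)\<in>P. cmod (g t - g s))"
      using P(2) assms(2) by (intro sum.cong refl) force
    then show "(\<Sum>(s, t)\<in>P. cmod (g t - g s)) < \<epsilon>" using \<eta>(2)[OF P] by simp
  qed
qed

lemma ACL_on_cong:
  assumes "ACL_on D f" "\<And>z. z \<in> D \<Longrightarrow> f z = g z"
  shows "ACL_on D g"
  unfolding ACL_on_def
proof (intro allI impI)
  fix a b c d assume sub: "cbox (Complex a c) (Complex b d) \<subseteq> D"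
  have eq: "f (Complex x y) = g (Complex x y)" if "a \<le> x" "x \<le> b" "c \<le> y" "y \<le> d" for x y
  proof -
    have "Complex x y \<in> cbox (Complex a c) (Complex b d)" using that by (simp add: in_cbox_complex_iff)
    then show ?thesis using sub assms(2) by blast
  qed
  have "(AE y in lborel. c \<le> y \<and> y \<le> d \<longrightarrow> absolutely_continuous_segment a b (\<lambda>x. f (Complex x y)))"
    "(AE x in lborel. a \<le> x \<and> x \<le> b \<longrightarrow> absolutely_continuous_segment c d (\<lambda>y. f (Complex x y)))"
    using assms(1) sub unfolding ACL_on_def by blast+
  then show "(AE y in lborel. c \<le> y \<and> y \<le> d \<longrightarrow> absolutely_continuous_segment a b (\<lambda>x. g (Complex x y))) \<and>
    (AE x in lborel. a \<le> x \<and> x \<le> b \<longrightarrow> absolutely_continuous_segment c d (\<lambda>y. g (Complex x y)))"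
    by (intro conjI; elim eventually_mono) (blast intro: eq absolutely_continuous_segment_cong)+
qed

lemma ACL_on_subset: "ACL_on D f \<Longrightarrow> D' \<subseteq> D \<Longrightarrow> ACL_on D' f"
  unfolding ACL_on_def by (meson subset_trans)

section \<open>Locality and affine invariance of the dilatation bound\<close>

lemma tendsto_Complex_Re: "((\<lambda>x. Complex x (Im z)) \<longlongrightarrow> z) (nhds (Re z))"
  by (rule tendsto_eq_rhs[OF tendsto_Complex[OF filterlim_ident tendsto_const]]) auto

lemma tendsto_Complex_Im: "((\<lambda>y. Complex (Re z) y) \<longlongrightarrow> z) (nhds (Im z))"
  by (rule tendsto_eq_rhs[OF tendsto_Complex[OF tendsto_const filterlim_ident]]) auto

lemma dilatation_le_at_cong:
  assumes "dilatation_le_at K f z" "eventually (\<lambda>w. f w = g w) (nhds z)"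
  shows "dilatation_le_at K g z"
proof -
  obtain u v where uv: "((\<lambda>x. f (Complex x (Im z))) has_vector_derivative u) (at (Re z))"
    "((\<lambda>y. f (Complex (Re z) y)) has_vector_derivative v) (at (Im z))"
    "cmod ((u + \<i> * v) / 2) \<le> (K - 1) / (K + 1) * cmod ((u - \<i> * v) / 2)"
    using assms(1) unfolding dilatation_le_at_def by blast
  have x: "eventually (\<lambda>x. f (Complex x (Im z)) = g (Complex x (Im z))) (nhds (Re z))"
    using eventually_compose_filterlim[OF assms(2) tendsto_Complex_Re] .
  have y: "eventually (\<lambda>y. f (Complex (Re z) y) = g (Complex (Re z) y)) (nhds (Im z))"
    using eventually_compose_filterlim[OF assms(2) tendsto_Complex_Im] .
  have "((\<lambda>x. g (Complex x (Im z))) has_vector_derivative u) (at (Re z))"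
    using uv(1) has_vector_derivative_cong_ev[where x = "Re z" and S = UNIV
        and f = "\<lambda>x. f (Complex x (Im z))" and g = "\<lambda>x. g (Complex x (Im z))"]
      eventually_nhds_x_imp_x[OF x] x by simp
  moreover have "((\<lambda>y. g (Complex (Re z) y)) has_vector_derivative v) (at (Im z))"
    using uv(2) has_vector_derivative_cong_ev[where x = "Im z" and S = UNIV
        and f = "\<lambda>y. f (Complex (Re z) y)" and g = "\<lambda>y. g (Complex (Re z) y)"]
      eventually_nhds_x_imp_x[OF y] y by simp
  ultimately show ?thesis using uv(3) unfolding dilatation_le_at_def by blast
qed

lemma dilatation_le_at_ident: "1 \<le> K \<Longrightarrow> dilatation_le_at K (\<lambda>z. z) z"
  unfolding dilatation_le_at_def
  by (rule exI[of _ 1], rule exI[of _ \<i>])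
     (auto simp: Complex_eq scaleR_conv_of_real has_vector_derivative_def intro!: derivative_eq_intros)

text \<open>Because \<open>a\<close> is real, horizontal and vertical lines keep their directions
  and the two partial derivatives do not mix. Both complex derivatives are multiplied by numbers of
  the same modulus, so their quotient keeps its size. The case \<open>a = -1\<close>,
  \<open>d = 1\<close> is the reflection.\<close>

lemma dilatation_le_at_affine:
  assumes "dilatation_le_at K g (of_real a * z + of_real d)"
  shows "dilatation_le_at K (\<lambda>w. c * g (of_real a * w + of_real d) + e) z"
proof -
  let ?z = "of_real a * z + of_real d"
  obtain u v where uv: "((\<lambda>x. g (Complex x (Im ?z))) has_vector_derivative u) (at (Re ?z))"
    "((\<lambda>y. g (Complex (Re ?z) y)) has_vector_derivative v) (at (Im ?z))"
    "cmod ((u + \<i> * v) / 2) \<le> (K - 1) / (K + 1) * cmod ((u - \<i> * v) / 2)"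
    using assms unfolding dilatation_le_at_def by blast
  have ax: "((\<lambda>x. a * x + d) has_vector_derivative a) (at x)" for x d
    by (auto intro!: derivative_eq_intros simp: has_vector_derivative_def)
  have X: "((\<lambda>x. g (Complex (a * x + d) (a * Im z))) has_vector_derivative a *\<^sub>R u) (at (Re z))"
    using vector_diff_chain_at[OF ax[of d "Re z"], of "\<lambda>x. g (Complex x (Im ?z))" u] uv(1)
    by (simp add: o_def)
  have Y: "((\<lambda>y. g (Complex (a * Re z + d) (a * y))) has_vector_derivative a *\<^sub>R v) (at (Im z))"
    using vector_diff_chain_at[OF ax[of 0 "Im z"], of "\<lambda>y. g (Complex (Re ?z) y)" v] uv(2)
    by (simp add: o_def)
  have eqX: "of_real a * Complex x (Im z) + of_real d = Complex (a * x + d) (a * Im z)" for x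
    by (simp add: complex_eq_iff)
  have eqY: "of_real a * Complex (Re z) y + of_real d = Complex (a * Re z + d) (a * y)" for y
    by (simp add: complex_eq_iff)
  have 1: "((\<lambda>x. c * g (of_real a * Complex x (Im z) + of_real d) + e) has_vector_derivative c * of_real a * u) (at (Re z))"
    unfolding eqX by (rule has_vector_derivative_eq_rhs, (rule derivative_intros X)+) (simp add: scaleR_conv_of_real)
  have 2: "((\<lambda>y. c * g (of_real a * Complex (Re z) y + of_real d) + e) has_vector_derivative c * of_real a * v) (at (Im z))"
    unfolding eqY by (rule has_vector_derivative_eq_rhs, (rule derivative_intros Y)+) (simp add: scaleR_conv_of_real)
  have e1: "(c * of_real a * u + \<i> * (c * of_real a * v)) / 2 = c * of_real a * ((u + \<i> * v) / 2)"
   and e2: "(c * of_real a * u - \<i> * (c * of_real a * v)) / 2 = c * of_real a * ((u - \<i> * v) / 2)"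
    by (simp_all add: algebra_simps add_divide_distrib diff_divide_distrib)
  have "cmod (c * of_real a) * cmod ((u + \<i> * v) / 2) \<le> cmod (c * of_real a) * ((K - 1) / (K + 1) * cmod ((u - \<i> * v) / 2))"
    using uv(3) by (rule mult_left_mono) simp
  then have 3: "cmod (c * of_real a * ((u + \<i> * v) / 2)) \<le> (K - 1) / (K + 1) * cmod (c * of_real a * ((u - \<i> * v) / 2))"
    by (simp only: norm_mult mult_ac)
  show ?thesis
    unfolding dilatation_le_at_def
    by (rule exI[of _ "c * of_real a * u"], rule exI[of _ "c * of_real a * v"], intro conjI 1 2)
       (simp only: e1 e2 3)
qed

section \<open>Extension to the sphere\<close>

lemma openin_riemann_sphere_Some_vimage:
  assumes "openin riemann_sphere U"
  shows "open {z :: complex. Some z \<in> U}"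
proof -
  have "openin euclidean {z \<in> topspace euclidean. Some z \<in> U}"
    using continuous_map_Some[of "euclidean :: complex topology"] assms openin_continuous_map_preimage by blast
  then show ?thesis by simp
qed

lemma openin_riemann_sphere_None:
  assumes "openin riemann_sphere U" "None \<in> U"
  obtains R where "R > 0" "\<And>z :: complex. cmod z > R \<Longrightarrow> Some z \<in> U"
proof -
  obtain C where C: "compact C" "U = insert None (Some ` (- C))"
    using assms unfolding openin_Alexandroff_compactification by (auto simp: Compl_eq_Diff_UNIV)
  then obtain R where "R > 0" "\<And>z. z \<in> C \<Longrightarrow> cmod z \<le> R"
    using compact_imp_bounded[OF C(1)] bounded_pos by metis
  then show ?thesis using that[of R] C(2) by force
qed

lemma continuous_map_riemann_sphere_map_option:
  assumes "continuous_on UNIV f" "continuous_on UNIV g" "\<And>z. g (f z) = z" "\<And>z. f (g z) = z"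
  shows "continuous_map riemann_sphere riemann_sphere (map_option f)"
  unfolding continuous_map_def
proof (intro conjI allI impI)
  show "map_option f \<in> topspace riemann_sphere \<rightarrow> topspace riemann_sphere"
    by (auto simp: notin_range_Some split: option.split)
  fix U assume "openin riemann_sphere U"
  then consider V where "open V" "U = Some ` V" | C where "compact C" "U = insert None (Some ` (- C))"
    unfolding openin_Alexandroff_compactification by (auto simp: Compl_eq_Diff_UNIV)
  then show "openin riemann_sphere {x \<in> topspace riemann_sphere. map_option f x \<in> U}"
  proof cases
    case 1
    have "{x \<in> topspace riemann_sphere. map_option f x \<in> U} = Some ` (f -` V)"
      using 1 by (auto simp: image_iff)
    moreover have "open (f -` V)" using 1 assms(1) by (simp add: open_vimage)
    ultimately show ?thesis by simp
  next
    case 2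
    \<comment> \<open>The preimage of a compact set is its image under the continuous inverse, hence
      compact: this is continuity at infinity.\<close>
    have fg: "f -` C = g ` C" using assms(4) by (auto intro: image_eqI[where f = g, OF assms(3)[symmetric]])
    have "{x \<in> topspace riemann_sphere. map_option f x \<in> U} = insert None (Some ` (- (f -` C)))"
      using 2 by (auto simp: image_iff)
    moreover have "compact (f -` C)"
      unfolding fg using 2(1) assms(2) by (intro compact_continuous_image) (auto intro: continuous_on_subset)
    ultimately show ?thesis
      unfolding openin_Alexandroff_compactification
      by (intro disjI2 exI[of _ "f -` C"]) (auto simp: compact_imp_closed Compl_eq_Diff_UNIV)
  qed
qed

lemma homeomorphic_map_riemann_sphere_map_option:
  assumes "continuous_on UNIV f" "continuous_on UNIV g" "\<And>z. g (f z) = z" "\<And>z. f (g z) = z"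
  shows "homeomorphic_map riemann_sphere riemann_sphere (map_option f)"
proof -
  have "homeomorphic_maps riemann_sphere riemann_sphere (map_option f) (map_option g)"
    unfolding homeomorphic_maps_def
    using continuous_map_riemann_sphere_map_option[OF assms]
      continuous_map_riemann_sphere_map_option[OF assms(2,1,4,3)]
    by (auto simp: option.map_comp o_def assms option.map_ident)
  then show ?thesis by (rule homeomorphic_maps_imp_map)
qed

lemma embedding_map_restrict:
  assumes "homeomorphic_map X Y f"
  shows "embedding_map (subtopology X U) Y f"
  unfolding embedding_map_def
proof -
  have "homeomorphic_map (subtopology X (topspace X \<inter> U)) (subtopology Y (f ` (topspace X \<inter> U))) f"
    by (rule homeomorphic_map_subtopologies_alt[OF assms]) 
       (use assms homeomorphic_imp_injective_map in \<open>auto simp: inj_on_def image_iff; blast\<close>)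
  then show "homeomorphic_map (subtopology X U) (subtopology Y (f ` topspace (subtopology X U))) f"
    by (simp add: subtopology_restrict topspace_subtopology)
qed

lemma plane_quasiconformal_on_restrict:
  assumes "continuous_on UNIV f" "continuous_on UNIV g" "\<And>z. g (f z) = z"
    and "ACL_on UNIV f" "1 \<le> K" "open D"
    and "AE z in lborel. z \<in> D \<longrightarrow> dilatation_le_at K f z"
  shows "plane_quasiconformal_on K D f"
proof -
  have "homeomorphism D (f ` D) f g"
    using assms(1-3) by (auto simp: homeomorphism_def image_iff intro: continuous_on_subset)
  then show ?thesis
    unfolding plane_quasiconformal_on_def using assms ACL_on_subset[of UNIV f D] by auto
qed

lemma ACL_on_ident: "ACL_on UNIV (\<lambda>z. z)"
proof -
  have "1-lipschitz_on X (\<lambda>x. Complex x y)" "1-lipschitz_on X (Complex y)" for X y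
    by (auto intro!: lipschitz_onI simp: dist_complex_def cmod_def dist_real_def)
  then show ?thesis
    unfolding ACL_on_def by (auto intro!: AE_I2 lipschitz_imp_absolutely_continuous)
qed

lemma plane_quasiconformal_on_eq_ident:
  assumes "open D" "1 \<le> K" "\<And>z. z \<in> D \<Longrightarrow> f z = z"
  shows "plane_quasiconformal_on K D f"
proof -
  have im: "f ` D = D" using assms(3) by force
  have "homeomorphism D (f ` D) f (\<lambda>z. z)"
    unfolding im using assms(3) by (auto simp: homeomorphism_def im cong: continuous_on_cong)
  moreover have "ACL_on D f"
    using ACL_on_cong[OF ACL_on_subset[OF ACL_on_ident, of D]] assms(3) by simp
  moreover have "dilatation_le_at K f z" if "z \<in> D" for z
  proof -
    have "eventually (\<lambda>w. w = f w) (nhds z)"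
      using assms(1,3) that unfolding eventually_nhds by force
    then show ?thesis using dilatation_le_at_cong[OF dilatation_le_at_ident[OF assms(2)]] by blast
  qed
  ultimately show ?thesis
    unfolding plane_quasiconformal_on_def using assms(1,2) by auto
qed

text \<open>As \<open>f\<close> is the identity far out, the chart \<open>1/z\<close> sees the
  identity near its origin, so the dilatation has to be controlled at finite points only.\<close>

lemma quasiconformal_on_map_option:
  assumes "continuous_on UNIV f" "continuous_on UNIV g" "\<And>z. g (f z) = z" "\<And>z. f (g z) = z"
    and "ACL_on UNIV f" "1 \<le> K" "openin riemann_sphere U"
    and "AE z in lborel. Some z \<in> U \<longrightarrow> dilatation_le_at K f z"
    and out: "\<And>z. cmod z > R \<Longrightarrow> f z = z"
  shows "quasiconformal_on K U (map_option f)"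
  unfolding quasiconformal_on_def
proof (intro conjI ballI)
  show "embedding_map (subtopology riemann_sphere U) riemann_sphere (map_option f)"
    by (intro embedding_map_restrict homeomorphic_map_riemann_sphere_map_option[of f g] assms)
  fix p assume p: "p \<in> U"
  show "\<exists>D. sphere_chart p p \<in> D \<and> sphere_param p ` D \<subseteq> U \<and>
        map_option f ` sphere_param p ` D \<subseteq> sphere_chart_dom (map_option f p) \<and>
        plane_quasiconformal_on K D (sphere_chart (map_option f p) \<circ> map_option f \<circ> sphere_param p)"
  proof (cases p)
    case (Some z)
    define D where "D = {z. Some z \<in> U}"
    have "sphere_chart (map_option f p) \<circ> map_option f \<circ> sphere_param p = f"
      by (auto simp: Some sphere_chart_def sphere_param_def)
    moreover have "plane_quasiconformal_on K D f"
      by (rule plane_quasiconformal_on_restrict[of _ g])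
         (use assms openin_riemann_sphere_Some_vimage in \<open>auto simp: D_def\<close>)
    ultimately show ?thesis
      using p Some by (intro exI[of _ D])
        (auto simp: sphere_chart_def sphere_param_def sphere_chart_dom_def D_def)
  next
    case None
    then obtain S where S: "S > 0" "\<And>z. cmod z > S \<Longrightarrow> Some z \<in> U"
      using openin_riemann_sphere_None[OF assms(7)] p by metis
    \<comment> \<open>For nonzero \<open>w\<close> in this disc, \<open>1 / w\<close> lies both in
      \<open>U\<close> and where \<open>f\<close> is the identity; \<open>S > 0\<close> keeps the
      radius positive whatever the sign of \<open>R\<close>.\<close>
    define D where "D = ball (0 :: complex) (1 / max R S)"
    have big: "cmod (1 / w) > max R S" if "w \<in> D" "w \<noteq> 0" for w
    proof -
      have "max R S > 0" using S(1) by (simp add: less_max_iff_disj)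
      then show ?thesis using that unfolding D_def by (simp add: norm_divide field_simps del: max_less_iff_conj)
    qed
    have id: "f (1 / w) = 1 / w" if "w \<in> D" "w \<noteq> 0" for w
      using big[OF that] out by auto
    have "plane_quasiconformal_on K D (sphere_chart (map_option f p) \<circ> map_option f \<circ> sphere_param p)"
      by (rule plane_quasiconformal_on_eq_ident)
         (use id assms(6) in \<open>auto simp: None sphere_chart_def sphere_param_def D_def\<close>)
    moreover have "0 \<in> D" using S(1) by (simp add: D_def less_max_iff_disj)
    moreover have "sphere_param p ` D \<subseteq> U"
      using big S(2) p by (auto simp: None sphere_param_def)
    ultimately show ?thesis
      using id by (intro exI[of _ D]) (auto simp: None sphere_chart_def sphere_param_def sphere_chart_dom_def)
  qed
qed (fact assms(7))

section \<open>The radial stretch\<close>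

locale thick =
  fixes \<delta> :: real
  assumes delta: "0 < \<delta>" "\<delta> < 1"
begin

text \<open>
  The sublevel set \<open>{z. focal z \<le> t}\<close> is the elliptic disc with foci \<open>0\<close> and \<open>t\<close> and major axis
  \<open>(1 + \<delta>) t\<close>.  The elliptic discs around the two children of \<open>[0, 1]\<close> are therefore
  the images of \<open>{z. focal z \<le> b}\<close> under the identity and under \<open>z \<mapsto> 1 - z\<close>, and
  \<open>rim\<close> is the largest level for which these two images do not overlap.
\<close>

definition focal :: "complex \<Rightarrow> real" where
  "focal z = 2 * ((1 + \<delta>) * cmod z - Re z) / (\<delta> * (2 + \<delta>))"

definition rim :: real where
  "rim = 1 / (2 + \<delta>)"

text \<open>The range of \<open>(1 - q) / 2\<close> for \<open>\<delta> \<le> q < 1\<close>.\<close>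

definition admissible :: "real \<Rightarrow> bool" where
  "admissible b \<longleftrightarrow> 0 < b \<and> b \<le> (1 - \<delta>) / 2"

lemma rim_bounds: "0 < rim" "rim < 1"
  using delta by (auto simp: rim_def)

lemma admissibleD:
  assumes "admissible b"
  shows "0 < b" "b < rim" "b < 1" "2 * b \<le> 1 - \<delta>"
proof -
  have "(1 - \<delta>) * (2 + \<delta>) = 2 - \<delta> - \<delta>\<^sup>2" by (simp add: power2_eq_square algebra_simps)
  then have "(1 - \<delta>) * (2 + \<delta>) < 2" using delta zero_less_power2[of \<delta>] by linarith
  then have "(1 - \<delta>) / 2 < rim" using delta by (simp add: rim_def field_simps)
  then show "b < rim" using assms by (simp add: admissible_def)
  show "0 < b" "b < 1" "2 * b \<le> 1 - \<delta>" using assms delta by (auto simp: admissible_def)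
qed

text \<open>The ring \<open>b \<le> focal z \<le> rim\<close> has logarithmic thickness
  \<open>ln (rim / b)\<close> along every ray. Its uniform lower bound yields the factor
  \<open>2 / \<delta>\<close> of \<open>dil_const\<close>.\<close>

lemma ln_rim_div_ge:
  assumes "admissible b"
  shows "\<delta> / 2 \<le> ln (rim / b)"
proof -
  note b = admissibleD[OF assms]
  have "b * (2 + \<delta>) \<le> (1 - \<delta>) / 2 * (2 + \<delta>)"
    using assms delta by (intro mult_right_mono) (auto simp: admissible_def)
  also have "\<dots> \<le> 1 - \<delta> / 2"
    using delta by (simp add: field_simps)
  finally have "b / rim \<le> 1 - \<delta> / 2" by (simp add: rim_def)
  then have "ln (b / rim) \<le> - (\<delta> / 2)"
    using ln_le_minus_one[of "b / rim"] b rim_bounds by simp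
  then show ?thesis using b rim_bounds by (simp add: ln_div)
qed

lemma focal_scale: "0 \<le> c \<Longrightarrow> focal (of_real c * z) = c * focal z"
  by (simp add: focal_def norm_mult algebra_simps diff_divide_distrib)

lemma focal_divide: "0 < c \<Longrightarrow> focal (z / of_real c) = focal z / c"
  using focal_scale[of "inverse c" z] by (simp add: field_simps)

lemma norm_le_focal: "cmod z \<le> (2 + \<delta>) / 2 * focal z"
proof -
  have "\<delta> * cmod z \<le> (1 + \<delta>) * cmod z - Re z"
    using complex_Re_le_cmod[of z] by (simp add: algebra_simps)
  then have "cmod z \<le> ((1 + \<delta>) * cmod z - Re z) / \<delta>" using delta by (simp add: field_simps)
  also have "\<dots> = (2 + \<delta>) / 2 * focal z" using delta by (simp add: focal_def divide_simps)
  finally show ?thesis .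
qed

lemma focal_nonneg: "0 \<le> focal z"
proof -
  have "0 \<le> (2 + \<delta>) / 2 * focal z" using norm_le_focal[of z] norm_ge_zero order_trans by blast
  then show ?thesis using delta by (simp add: zero_le_mult_iff)
qed

lemma focal_pos: "z \<noteq> 0 \<Longrightarrow> 0 < focal z"
  using norm_le_focal[of z] focal_nonneg[of z] by (cases "focal z = 0") auto

lemma norm_le_half:
  assumes "focal z \<le> rim"
  shows "cmod z \<le> 1 / 2"
proof -
  have "(2 + \<delta>) / 2 * focal z \<le> (2 + \<delta>) / 2 * rim"
    using assms delta by (intro mult_left_mono) auto
  also have "\<dots> = 1 / 2" using delta by (simp add: rim_def)
  finally show ?thesis using norm_le_focal[of z] by simp
qed

lemma Re_less_half:
  assumes "focal z < rim"
  shows "Re z < 1 / 2"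
proof -
  have "(2 + \<delta>) / 2 * focal z < (2 + \<delta>) / 2 * rim"
    using assms delta by (intro mult_strict_left_mono) auto
  also have "\<dots> = 1 / 2" using delta by (simp add: rim_def)
  finally show ?thesis using norm_le_focal[of z] complex_Re_le_cmod[of z] by simp
qed

lemma Re_le_half: "focal z \<le> rim \<Longrightarrow> Re z \<le> 1 / 2"
  using norm_le_half[of z] complex_Re_le_cmod[of z] by simp

lemma rim_le_focal: "1 / 2 \<le> Re z \<Longrightarrow> rim \<le> focal z"
  using Re_less_half[of z] by fastforce

lemma focal_of_real: "0 \<le> x \<Longrightarrow> focal (of_real x) = 2 * x / (2 + \<delta>)"
proof -
  assume "0 \<le> x"
  then have "focal (of_real x) = 2 * (\<delta> * x) / (\<delta> * (2 + \<delta>))" by (simp add: focal_def distrib_right)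
  then show ?thesis using delta by simp
qed

text \<open>In the focal equation \<open>cmod (1 - z) = 1 + \<delta> - cmod z\<close> the quadratic
  terms cancel after squaring, which leaves an expression affine in \<open>cmod z\<close> and
  \<open>Re z\<close>. This is where \<open>focal\<close> and its normalisation come from.\<close>

lemma focal_identity:
  "(cmod (1 - z))\<^sup>2 - (1 + \<delta> - cmod z)\<^sup>2 = \<delta> * (2 + \<delta>) * (focal z - 1)"
proof -
  have "(cmod (1 - z))\<^sup>2 = (cmod z)\<^sup>2 - 2 * Re z + 1"
    by (simp only: cmod_power2) (simp add: power2_eq_square algebra_simps)
  moreover have "\<delta> * (2 + \<delta>) * focal z = 2 * ((1 + \<delta>) * cmod z - Re z)"
    using delta by (simp add: focal_def)
  ultimately show ?thesis by (simp add: power2_eq_square algebra_simps)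
qed

lemma focal_le_1_iff: "focal z \<le> 1 \<longleftrightarrow> cmod z + cmod (1 - z) \<le> 1 + \<delta>"
proof -
  have *: "focal z \<le> 1 \<longleftrightarrow> (cmod (1 - z))\<^sup>2 \<le> (1 + \<delta> - cmod z)\<^sup>2"
  proof -
    have "0 < \<delta> * (2 + \<delta>)" using delta by simp
    then have "focal z - 1 \<le> 0 \<longleftrightarrow> \<delta> * (2 + \<delta>) * (focal z - 1) \<le> 0"
      using delta by (simp add: mult_le_0_iff)
    then show ?thesis using focal_identity[of z] by linarith
  qed
  show ?thesis
  proof
    assume f: "focal z \<le> 1"
    \<comment> \<open>Taking square roots requires \<open>cmod z \<le> 1 + \<delta>\<close>, which
      the cruder bound \<open>norm_le_focal\<close> supplies.\<close>
    then have "(2 + \<delta>) / 2 * focal z \<le> (2 + \<delta>) / 2 * 1" using delta by (intro mult_left_mono) auto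
    then have "cmod z \<le> (2 + \<delta>) / 2 * 1" using norm_le_focal[of z] by (rule order_trans[rotated])
    then have "0 \<le> 1 + \<delta> - cmod z" using delta by simp
    then show "cmod z + cmod (1 - z) \<le> 1 + \<delta>"
      using f * power2_le_imp_le by fastforce
  next
    assume "cmod z + cmod (1 - z) \<le> 1 + \<delta>"
    then have "(cmod (1 - z))\<^sup>2 \<le> (1 + \<delta> - cmod z)\<^sup>2" by (intro power_mono) auto
    then show "focal z \<le> 1" using * by simp
  qed
qed

lemma focal_eq_1_iff: "focal z = 1 \<longleftrightarrow> cmod z + cmod (1 - z) = 1 + \<delta>"
proof
  assume f: "focal z = 1"
  then have "(cmod (1 - z))\<^sup>2 = (1 + \<delta> - cmod z)\<^sup>2" using focal_identity[of z] by simp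
  moreover have "0 \<le> 1 + \<delta> - cmod z" using norm_le_focal[of z] delta f by simp
  ultimately show "cmod z + cmod (1 - z) = 1 + \<delta>"
    using power2_eq_imp_eq[of "cmod (1 - z)" "1 + \<delta> - cmod z"] by simp
next
  assume "cmod z + cmod (1 - z) = 1 + \<delta>"
  then have "1 + \<delta> - cmod z = cmod (1 - z)" by simp
  then show "focal z = 1" using focal_identity[of z] delta by simp
qed

text \<open>Among the homothetic ellipses, level \<open>1\<close> is the one with foci
  \<open>0\<close> and \<open>1\<close>; it is symmetric because the sum of the distances to the
  foci is.\<close>

lemma focal_reflect_le_1: "focal (1 - z) \<le> 1 \<longleftrightarrow> focal z \<le> 1"
  by (simp add: focal_le_1_iff add.commute)

lemma focal_reflect_less_1: "focal (1 - z) < 1 \<longleftrightarrow> focal z < 1"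
  using focal_le_1_iff[of z] focal_le_1_iff[of "1 - z"] focal_eq_1_iff[of z] focal_eq_1_iff[of "1 - z"]
  by (auto simp: less_le add.commute)

lemma focal_ge_1_reflect: "1 \<le> focal z \<Longrightarrow> rim \<le> focal (1 - z)"
  using focal_reflect_less_1[of z] rim_bounds by force

lemma continuous_focal: "continuous_on S focal"
  unfolding focal_def using delta by (intro continuous_intros) auto

lemma lipschitz_focal: "\<exists>L. L-lipschitz_on S focal"
proof (intro exI lipschitz_onI)
  fix x y :: complex
  have "\<bar>cmod x - cmod y\<bar> \<le> cmod (x - y)" "\<bar>Re x - Re y\<bar> \<le> cmod (x - y)"
    using norm_triangle_ineq3[of x y] abs_Re_le_cmod[of "x - y"] by auto
  moreover from this have "(1 + \<delta>) * \<bar>cmod x - cmod y\<bar> \<le> (1 + \<delta>) * cmod (x - y)"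
    using delta by (intro mult_left_mono) auto
  then have "\<bar>(1 + \<delta>) * (cmod x - cmod y)\<bar> \<le> (1 + \<delta>) * cmod (x - y)"
    using delta by (simp add: abs_mult)
  ultimately have 1: "\<bar>(1 + \<delta>) * (cmod x - cmod y) - (Re x - Re y)\<bar> \<le> (1 + \<delta>) * cmod (x - y) + cmod (x - y)"
    by simp
  have "focal x - focal y = 2 / (\<delta> * (2 + \<delta>)) * ((1 + \<delta>) * (cmod x - cmod y) - (Re x - Re y))"
    by (simp add: focal_def algebra_simps diff_divide_distrib add_divide_distrib)
  moreover have "0 \<le> 2 / (\<delta> * (2 + \<delta>))" using delta by simp
  ultimately have "\<bar>focal x - focal y\<bar> = 2 / (\<delta> * (2 + \<delta>)) * \<bar>(1 + \<delta>) * (cmod x - cmod y) - (Re x - Re y)\<bar>"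
    by (simp only: abs_mult abs_of_nonneg)
  also have "\<dots> \<le> 2 / (\<delta> * (2 + \<delta>)) * ((1 + \<delta>) * cmod (x - y) + cmod (x - y))"
    using 1 delta by (intro mult_left_mono) auto
  finally show "dist (focal x) (focal y) \<le> (2 / (\<delta> * (2 + \<delta>)) * (2 + \<delta>)) * dist x y"
    by (simp add: dist_norm distrib_right add_divide_distrib algebra_simps)
qed (use delta in auto)

text \<open>The factor by which a point with \<open>focal z = t\<close> is stretched along its ray.
  The exponent makes \<open>t powr\<close> interpolate between \<open>b' / b\<close> at
  \<open>t = b\<close> and \<open>1\<close> at \<open>t = rim\<close>; clamping \<open>t\<close>
  continues the factor by these constants.\<close>

definition radial :: "real \<Rightarrow> real \<Rightarrow> real \<Rightarrow> real" where
  "radial b b' t = (max b (min rim t) / rim) powr (ln (b' / b) / ln (b / rim))"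

lemma radial_outer:
  assumes "b < rim" "rim \<le> t"
  shows "radial b b' t = 1"
  using assms rim_bounds by (simp add: radial_def)

lemma radial_inner:
  assumes "0 < b" "b < rim" "0 < b'" "t \<le> b"
  shows "radial b b' t = b' / b"
proof -
  have "ln (b / rim) \<noteq> 0" using assms rim_bounds by simp
  moreover have "max b (min rim t) = b" using assms by auto
  ultimately show ?thesis using assms rim_bounds by (simp add: radial_def powr_def)
qed

lemma radial_mid:
  assumes "b \<le> t" "t \<le> rim"
  shows "radial b b' t = (t / rim) powr (ln (b' / b) / ln (b / rim))"
  using assms by (simp add: radial_def max_def)

text \<open>The product \<open>t * radial b b' t\<close> is the value of \<open>focal\<close> after
  the stretch. In the coordinate \<open>ln (t / rim)\<close> the passage to it is multiplication by
  a positive constant that takes \<open>ln (b / rim)\<close> to \<open>ln (b' / rim)\<close>, so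
  \<open>[b, rim]\<close> goes into \<open>[b', rim]\<close>.\<close>

lemma radial_profile:
  assumes "0 < b" "b < rim" "0 < b'" "b' < rim" "b \<le> t" "t \<le> rim"
  shows "t * radial b b' t = rim * exp (ln (b' / rim) / ln (b / rim) * ln (t / rim))"
    and "b' \<le> t * radial b b' t" and "t * radial b b' t \<le> rim"
proof -
  have t: "0 < t" using assms by simp
  have n: "ln (b / rim) < 0" "ln (b' / rim) < 0" using assms rim_bounds by auto
  have "t * radial b b' t = rim * exp (ln (t / rim)) * exp (ln (b' / b) / ln (b / rim) * ln (t / rim))"
    using assms t rim_bounds by (simp add: radial_mid powr_def)
  also have "\<dots> = rim * exp ((1 + ln (b' / b) / ln (b / rim)) * ln (t / rim))"
    by (simp add: exp_add algebra_simps)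
  also have "1 + ln (b' / b) / ln (b / rim) = ln (b' / rim) / ln (b / rim)"
    using n(1) assms rim_bounds by (simp add: field_simps ln_div)
  finally show eq: "t * radial b b' t = rim * exp (ln (b' / rim) / ln (b / rim) * ln (t / rim))" .
  have a: "0 < ln (b' / rim) / ln (b / rim)" using n by (simp add: zero_less_divide_iff)
  have "ln (t / rim) \<le> 0" using assms t rim_bounds by simp
  then have "ln (b' / rim) / ln (b / rim) * ln (t / rim) \<le> 0" using a by (intro mult_nonneg_nonpos) auto
  then show "t * radial b b' t \<le> rim" unfolding eq using rim_bounds by simp
  have "ln (b / rim) \<le> ln (t / rim)" using assms t rim_bounds by (simp add: divide_right_mono)
  then have "ln (b' / rim) / ln (b / rim) * ln (b / rim) \<le> ln (b' / rim) / ln (b / rim) * ln (t / rim)"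
    using a by (intro mult_left_mono) auto
  then have "exp (ln (b' / rim)) \<le> exp (ln (b' / rim) / ln (b / rim) * ln (t / rim))"
    using n by simp
  then have "b' / rim \<le> exp (ln (b' / rim) / ln (b / rim) * ln (t / rim))"
    using assms rim_bounds by simp
  then show "b' \<le> t * radial b b' t" unfolding eq using rim_bounds by (simp add: field_simps)
qed

text \<open>Exchanging \<open>b\<close> and \<open>b'\<close> inverts the slope in the coordinate
  \<open>ln (t / rim)\<close>. The form with a product suits the stretch, which multiplies points by
  these factors.\<close>

lemma radial_inverse:
  assumes "0 < b" "b < rim" "0 < b'" "b' < rim" "b \<le> t" "t \<le> rim"
  shows "radial b' b (t * radial b b' t) * radial b b' t = 1"
proof -
  define s where "s = t * radial b b' t"
  have t: "0 < t" using assms by simp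
  have n: "ln (b / rim) < 0" "ln (b' / rim) < 0" using assms rim_bounds by auto
  have s: "b' \<le> s" "s \<le> rim" using radial_profile[OF assms] by (auto simp: s_def)
  have lns: "ln (s / rim) = ln (b' / rim) / ln (b / rim) * ln (t / rim)"
    using radial_profile(1)[OF assms] rim_bounds by (simp add: s_def)
  have "s * radial b' b s = rim * exp (ln (b / rim) / ln (b' / rim) * ln (s / rim))"
    by (rule radial_profile(1)) (use assms s in auto)
  also have "ln (b / rim) / ln (b' / rim) * ln (s / rim) = ln (t / rim)"
    unfolding lns using n by simp
  also have "rim * exp (ln (t / rim)) = t" using t rim_bounds by simp
  finally have "t * (radial b b' t * radial b' b s) = t" by (simp add: s_def mult_ac)
  then show ?thesis using t by (simp add: s_def mult_ac)
qed

lemma radial_pos: "0 < b \<Longrightarrow> 0 < radial b b' t"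
  using rim_bounds by (simp add: radial_def)

lemma focal_radial: "0 < b \<Longrightarrow> focal (of_real (radial b b' t) * z) = focal z * radial b b' t"
  by (simp only: focal_scale less_imp_le[OF radial_pos] mult.commute[of "focal z"])

text \<open>Clamping does not increase distances, and a power is continuously differentiable on
  \<open>[b, rim]\<close>, which stays away from \<open>0\<close>.\<close>

lemma lipschitz_radial:
  assumes "0 < b" "b < rim"
  shows "\<exists>L. L-lipschitz_on S (radial b b')"
proof -
  define \<kappa> where "\<kappa> = ln (b' / b) / ln (b / rim)"
  define p where "p = (\<lambda>t. (t / rim) powr \<kappa>)"
  define p' where "p' = (\<lambda>t. \<kappa> * (t / rim) powr (\<kappa> - 1) / rim)"
  have d: "(p has_field_derivative p' t) (at t within {b..rim})" if "t \<in> {b..rim}" for t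
    unfolding p_def p'_def using that assms rim_bounds
    by (auto intro!: derivative_eq_intros simp: powr_diff field_simps)
  have "continuous_on {b..rim} p'"
    unfolding p'_def using assms rim_bounds by (intro continuous_intros) auto
  then have "bounded (p' ` {b..rim})" by (intro compact_imp_bounded compact_continuous_image) auto
  then obtain B where B: "0 < B" "\<And>t. t \<in> {b..rim} \<Longrightarrow> norm (p' t) \<le> B" by (auto simp: bounded_pos)
  have lip: "\<bar>p x - p y\<bar> \<le> B * \<bar>x - y\<bar>" if "x \<in> {b..rim}" "y \<in> {b..rim}" for x y
    using field_differentiable_bound[OF _ d B(2), of x y] that by (simp add: norm_minus_commute)
  have "B-lipschitz_on S (radial b b')"
  proof (rule lipschitz_onI)
    fix x y
    have "\<bar>max b (min rim x) - max b (min rim y)\<bar> \<le> \<bar>x - y\<bar>" by (auto simp: max_def min_def)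
    then have "B * \<bar>max b (min rim x) - max b (min rim y)\<bar> \<le> B * \<bar>x - y\<bar>" using B(1) by simp
    then have "\<bar>p (max b (min rim x)) - p (max b (min rim y))\<bar> \<le> B * \<bar>x - y\<bar>"
      by (rule order_trans[OF lip, rotated 2]) (use assms in auto)
    moreover have "radial b b' u = p (max b (min rim u))" for u by (simp add: radial_def p_def \<kappa>_def)
    ultimately show "dist (radial b b' x) (radial b b' y) \<le> B * dist x y"
      by (simp only: dist_real_def)
  qed (use B in simp)
  then show ?thesis by blast
qed

text \<open>
  If \<open>F\<close> fixes the points outside the elliptic disc of \<open>[0, 1]\<close>, then \<open>half_step b b' F z\<close> is
  \<open>b' F (z/b)\<close> where \<open>focal z \<le> b\<close> (the second summand vanishes), \<open>radial b b' (focal z) z\<close>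
  where \<open>focal z \<ge> b\<close> (there \<open>F (z/b) = z/b\<close>), and \<open>z\<close> where \<open>focal z \<ge> rim\<close>.
  Since \<open>z\<close> and \<open>1 - z\<close> are never both moved, \<open>full_step\<close> glues \<open>half_step\<close> to its mirror image
  without a case distinction, which keeps continuity and Lipschitz bounds immediate.
\<close>

definition half_step :: "real \<Rightarrow> real \<Rightarrow> (complex \<Rightarrow> complex) \<Rightarrow> complex \<Rightarrow> complex" where
  "half_step b b' F z = of_real b' * F (z / of_real b) + of_real (radial b b' (focal z) - b' / b) * z"

definition full_step :: "real \<Rightarrow> real \<Rightarrow> (complex \<Rightarrow> complex) \<Rightarrow> complex \<Rightarrow> complex" where
  "full_step b b' F z = half_step b b' F z + 1 - half_step b b' F (1 - z) - z"

definition fixes_outside :: "(complex \<Rightarrow> complex) \<Rightarrow> bool" where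
  "fixes_outside F \<longleftrightarrow> (\<forall>z. 1 \<le> focal z \<longrightarrow> F z = z)"

section \<open>The zones of a single step\<close>

lemma half_step_far:
  assumes "fixes_outside F" "0 < b" "b \<le> focal z"
  shows "half_step b b' F z = of_real (radial b b' (focal z)) * z"
proof -
  have "F (z / of_real b) = z / of_real b"
    using assms by (auto simp: fixes_outside_def focal_divide)
  then show ?thesis using assms by (simp add: half_step_def left_diff_distrib)
qed

lemma half_step_outer:
  assumes "fixes_outside F" "0 < b" "b < rim" "rim \<le> focal z"
  shows "half_step b b' F z = z"
  using assms half_step_far[of F b z b'] by (simp add: radial_outer)

lemma half_step_inner:
  assumes "0 < b" "b < rim" "0 < b'" "focal z \<le> b"
  shows "half_step b b' F z = of_real b' * F (z / of_real b)"
  using assms by (simp add: half_step_def radial_inner)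

lemma full_step_reflect: "full_step b b' F (1 - z) = 1 - full_step b b' F z"
  by (simp add: full_step_def)

lemma full_step_left:
  assumes "fixes_outside F" "0 < b" "b < rim" "Re z \<le> 1 / 2"
  shows "full_step b b' F z = half_step b b' F z"
  using half_step_outer[OF assms(1-3), of "1 - z"] rim_le_focal[of "1 - z"] assms(4)
  by (simp add: full_step_def)

lemma full_step_outer:
  assumes "fixes_outside F" "0 < b" "b < rim" "rim \<le> focal z" "Re z \<le> 1 / 2"
  shows "full_step b b' F z = z"
  using assms by (simp add: full_step_left half_step_outer)

lemma full_step_ring:
  assumes "fixes_outside F" "0 < b" "b < rim" "b \<le> focal z" "focal z \<le> rim"
  shows "full_step b b' F z = of_real (radial b b' (focal z)) * z"
  using full_step_left[OF assms(1-3)] half_step_far[OF assms(1,2,4)] Re_le_half[OF assms(5)] by simp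

lemma full_step_inner:
  assumes "fixes_outside F" "0 < b" "b < rim" "0 < b'" "focal z \<le> b"
  shows "full_step b b' F z = of_real b' * F (z / of_real b)"
  using full_step_left[OF assms(1-3)] half_step_inner[OF assms(2-5)] Re_le_half[of z] assms(3,5) by simp

lemma fixes_outside_full_step:
  assumes "fixes_outside F" "0 < b" "b < rim"
  shows "fixes_outside (full_step b b' F)"
  unfolding fixes_outside_def
proof (intro allI impI)
  fix z assume z: "1 \<le> focal z"
  then have "rim \<le> focal z" "rim \<le> focal (1 - z)" using rim_bounds focal_ge_1_reflect by auto
  then show "full_step b b' F z = z"
    using assms by (simp add: full_step_def half_step_outer)
qed

text \<open>Disposes of the mirror image once: the right half reduces to the left one, where three
  zones overlapping along their boundaries suffice.\<close>

lemma full_step_cases [consumes 3, case_names outer ring inner reflect]: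
  assumes "fixes_outside F" "0 < b" "b < rim"
    and outer: "\<And>z. rim \<le> focal z \<Longrightarrow> Re z \<le> 1 / 2 \<Longrightarrow> P z"
    and ring: "\<And>z. b \<le> focal z \<Longrightarrow> focal z \<le> rim \<Longrightarrow> P z"
    and inner: "\<And>z. focal z \<le> b \<Longrightarrow> P z"
    and reflect: "\<And>z. 1 / 2 < Re z \<Longrightarrow> P (1 - z) \<Longrightarrow> P z"
  shows "P z"
proof -
  have left: "P z" if "Re z \<le> 1 / 2" for z
    using that outer ring inner by (meson linear)
  show ?thesis
  proof (cases "Re z \<le> 1 / 2")
    case False
    then show ?thesis using left[of "1 - z"] reflect by simp
  qed (rule left)
qed

text \<open>Keeps the image of the left elliptic disc on the left of
  \<open>Re z = 1 / 2\<close>.\<close>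

lemma full_step_focal_le_rim:
  assumes F: "fixes_outside F" and le1: "\<And>z. focal z \<le> 1 \<Longrightarrow> focal (F z) \<le> 1"
    and b: "0 < b" "b < rim" "0 < b'" "b' < rim" and z: "focal z \<le> rim"
  shows "focal (full_step b b' F z) \<le> rim"
proof (cases "focal z \<le> b")
  case True
  then have "focal (F (z / of_real b)) \<le> 1"
    using b by (intro le1) (simp add: focal_divide)
  then have "b' * focal (F (z / of_real b)) \<le> b' * 1" using b by (intro mult_left_mono) auto
  then have "b' * focal (F (z / of_real b)) \<le> rim" using b by linarith
  then show ?thesis using True F b by (simp add: full_step_inner focal_scale)
next
  case False
  then show ?thesis
    using full_step_ring[OF F b(1,2) _ z] radial_profile(3)[OF b _ z] focal_radial[OF b(1)]
    by simp
qed

lemma full_step_focal_le_1: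
  assumes F: "fixes_outside F" and le1: "\<And>z. focal z \<le> 1 \<Longrightarrow> focal (F z) \<le> 1"
    and b: "0 < b" "b < rim" "0 < b'" "b' < rim" and z: "focal z \<le> 1"
  shows "focal (full_step b b' F z) \<le> 1"
  using F b(1,2) z
proof (induct z rule: full_step_cases)
  case (reflect z)
  then show ?case
    using focal_reflect_le_1[of z] focal_reflect_le_1[of "full_step b b' F z"]
    by (simp add: full_step_reflect)
next
  case (outer z)
  then show ?case using F b by (simp add: full_step_outer)
next
  case (ring z)
  then show ?case using full_step_focal_le_rim[OF F le1 b, of z] rim_bounds by simp
next
  case (inner z)
  then show ?case using full_step_focal_le_rim[OF F le1 b, of z] rim_bounds b by simp
qed

text \<open>The outer part, the ring and the inner disc for \<open>b\<close> are carried into those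
  for \<open>b'\<close>, so the exchanged step applies the matching inverse formula;
  \<open>le1\<close> is what keeps the inner image inside level \<open>b'\<close>.\<close>

lemma full_step_inverse:
  assumes F: "fixes_outside F" and G: "fixes_outside G" 
    and le1: "\<And>z. focal z \<le> 1 \<Longrightarrow> focal (F z) \<le> 1"
    and GF: "\<And>z. G (F z) = z"
    and b: "0 < b" "b < rim" "0 < b'" "b' < rim"
  shows "full_step b' b G (full_step b b' F z) = z"
  using F b(1,2)
proof (induct z rule: full_step_cases)
  case (outer z)
  then show ?case using F G b by (simp add: full_step_outer)
next
  case (ring z)
  note focal_radial[OF b(1), of b' "focal z" z]
  moreover note radial_profile[OF b ring] radial_inverse[OF b ring]
  ultimately show ?case
    using F G b ring full_step_ring[OF G b(3,4), of "of_real (radial b b' (focal z)) * z" b]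
    by (simp add: full_step_ring flip: mult.assoc of_real_mult)
next
  case (inner z)
  have "focal (F (z / of_real b)) \<le> 1"
    using b inner by (intro le1) (simp add: focal_divide)
  then have "b' * focal (F (z / of_real b)) \<le> b' * 1" using b by (intro mult_left_mono) auto
  then show ?case using F G b inner
    by (simp add: full_step_inner focal_scale GF)
next
  case (reflect z)
  then show ?case by (simp add: full_step_reflect)
qed

text \<open>Unless the factor is \<open>1\<close>, both the point and its stretched image lie in the
  disc of radius \<open>1 / 2\<close>. This starts the induction in
  \<open>approx_diff_le\<close>.\<close>

lemma radial_displacement:
  assumes "0 < b" "b < rim" "0 < b'" "b' < rim"
  shows "cmod (of_real (radial b b' (focal z) - 1) * z) \<le> 1"
proof (cases "rim \<le> focal z")
  case True
  then show ?thesis using assms by (simp add: radial_outer)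
next
  case False
  let ?r = "radial b b' (focal z)"
  have "focal z * ?r \<le> rim"
  proof (cases "focal z \<le> b")
    case True
    then have "focal z * (b' / b) \<le> b * (b' / b)" using assms by (intro mult_right_mono) auto
    then show ?thesis using assms True by (simp add: radial_inner)
  next
    case 2: False
    then show ?thesis using radial_profile(3)[OF assms] False by simp
  qed
  then have "focal (of_real ?r * z) \<le> rim"
    using focal_radial[OF assms(1)] by simp
  then have "cmod (of_real ?r * z) \<le> 1 / 2" "cmod z \<le> 1 / 2"
    using norm_le_half False by auto
  moreover have "of_real (?r - 1) * z = of_real ?r * z - z" by (simp add: left_diff_distrib)
  ultimately show ?thesis using norm_triangle_ineq4[of "of_real ?r * z" z] by simp
qed


section \<open>The map between two Cantor sets\<close>

definition admissible_seq :: "(nat \<Rightarrow> real) \<Rightarrow> bool" where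
  "admissible_seq b \<longleftrightarrow> (\<forall>n. admissible (b n))"

definition shift :: "(nat \<Rightarrow> real) \<Rightarrow> nat \<Rightarrow> real" where
  "shift b n = b (Suc n)"

lemma admissible_seq_shift: "admissible_seq b \<Longrightarrow> admissible_seq (shift b)"
  by (simp add: admissible_seq_def shift_def)

lemma admissible_seqD:
  assumes "admissible_seq b"
  shows "0 < b n" "b n < rim" "b n < 1" "2 * b n \<le> 1 - \<delta>"
  using assms admissibleD unfolding admissible_seq_def by blast+

primrec approx :: "nat \<Rightarrow> (nat \<Rightarrow> real) \<Rightarrow> (nat \<Rightarrow> real) \<Rightarrow> complex \<Rightarrow> complex" where
  "approx 0 b b' = (\<lambda>z. z)"
| "approx (Suc k) b b' = full_step (b 0) (b' 0) (approx k (shift b) (shift b'))"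

lemma fixes_outside_approx: "admissible_seq b \<Longrightarrow> fixes_outside (approx k b b')"
proof (induction k arbitrary: b b')
  case (Suc k)
  then show ?case
    using admissible_seqD[OF Suc.prems, of 0] by (simp add: fixes_outside_full_step admissible_seq_shift)
qed (simp add: fixes_outside_def)

lemma approx_focal_le_1:
  assumes "admissible_seq b" "admissible_seq b'" "focal z \<le> 1"
  shows "focal (approx k b b' z) \<le> 1"
  using assms
proof (induction k arbitrary: b b' z)
  case (Suc k)
  show ?case unfolding approx.simps
    by (intro full_step_focal_le_1 fixes_outside_approx Suc.IH)
       (use Suc.prems admissible_seqD[of b 0] admissible_seqD[of b' 0] in \<open>auto intro: admissible_seq_shift\<close>)
qed simp

lemma approx_inverse:
  assumes "admissible_seq b" "admissible_seq b'"
  shows "approx k b' b (approx k b b' z) = z"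
  using assms
proof (induction k arbitrary: b b' z)
  case (Suc k)
  show ?case unfolding approx.simps
    by (intro full_step_inverse fixes_outside_approx Suc.IH approx_focal_le_1)
       (use Suc.prems admissible_seqD[of b 0] admissible_seqD[of b' 0] in \<open>auto intro: admissible_seq_shift\<close>)
qed simp

text \<open>Balls are used because the product of the radial factor with \<open>z\<close> is
  estimated through a bound on \<open>z\<close>. The hypothesis ranges over all radii because
  \<open>z / b\<close> lies in a larger ball.\<close>

lemma lipschitz_half_step:
  assumes F: "\<And>M. \<exists>L. L-lipschitz_on (cball 0 M) F" and b: "0 < b" "b < rim" "0 < b'"
  shows "\<exists>L. L-lipschitz_on (cball 0 M) (half_step b b' F)"
proof -
  define g where "g z = radial b b' (focal z) - b' / b" for z
  obtain L where L: "L-lipschitz_on (cball 0 (\<bar>M\<bar> / b)) F" using F by blast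
  have L0: "0 \<le> L" using L by (rule lipschitz_on_nonneg)
  obtain L1 where L1: "L1-lipschitz_on UNIV focal" using lipschitz_focal by blast
  obtain L2 where L2: "L2-lipschitz_on (range focal) (radial b b')" using lipschitz_radial b by blast
  have "(L2 * L1)-lipschitz_on UNIV (\<lambda>z. radial b b' (focal z))"
    using lipschitz_on_compose2[OF L1 L2] .
  then have "0 \<le> L2 * L1" "\<And>x y. \<bar>g x - g y\<bar> \<le> L2 * L1 * cmod (x - y)"
    using lipschitz_on_nonneg lipschitz_on_normD[of "L2 * L1" UNIV "\<lambda>z. radial b b' (focal z)"]
    by (auto simp: g_def)
  then obtain G where G: "0 \<le> G" "\<And>x y. \<bar>g x - g y\<bar> \<le> G * cmod (x - y)" by blast
  \<comment> \<open>The first summand comes from the rescaled \<open>F\<close>. The other two come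
    from the product rule: \<open>g x\<close> times the difference, and the difference of
    \<open>g\<close> times \<open>y\<close>.\<close>
  let ?C = "b' * (L / b) + ((\<bar>g 0\<bar> + G * \<bar>M\<bar>) + G * \<bar>M\<bar>)"
  have "?C-lipschitz_on (cball 0 M) (half_step b b' F)"
  proof (rule lipschitz_onI)
    fix x y :: complex assume "x \<in> cball 0 M" "y \<in> cball 0 M"
    then have xy: "cmod x \<le> \<bar>M\<bar>" "cmod y \<le> \<bar>M\<bar>" by auto
    have "cmod (F (x / b) - F (y / b)) \<le> L * cmod (x / b - y / b)"
      using lipschitz_onD[OF L, of "x / b" "y / b"] xy b by (simp add: dist_norm norm_divide divide_right_mono)
    also have "\<dots> = L / b * cmod (x - y)" using b by (simp add: norm_divide flip: diff_divide_distrib)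
    finally have 1: "cmod (of_real b' * (F (x / b) - F (y / b))) \<le> b' * (L / b * cmod (x - y))"
      unfolding norm_mult using b by (simp only: norm_of_real abs_of_pos) (rule mult_left_mono, auto)
    have "\<bar>g x\<bar> \<le> \<bar>g 0\<bar> + G * cmod x" using G(2)[of x 0] by simp
    also have "\<dots> \<le> \<bar>g 0\<bar> + G * \<bar>M\<bar>" using G(1) xy by (simp add: mult_left_mono)
    finally have "cmod (of_real (g x) * (x - y)) \<le> (\<bar>g 0\<bar> + G * \<bar>M\<bar>) * cmod (x - y)"
      by (simp add: norm_mult mult_right_mono)
    moreover have "cmod (of_real (g x - g y) * y) \<le> (G * cmod (x - y)) * \<bar>M\<bar>"
      unfolding norm_mult norm_of_real using G xy by (intro mult_mono) auto
    ultimately have 2: "cmod (of_real (g x) * (x - y) + of_real (g x - g y) * y)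
        \<le> ((\<bar>g 0\<bar> + G * \<bar>M\<bar>) + G * \<bar>M\<bar>) * cmod (x - y)"
      by (intro order_trans[OF norm_triangle_ineq]) (simp add: algebra_simps)
    have "half_step b b' F x - half_step b b' F y =
        of_real b' * (F (x / b) - F (y / b)) + (of_real (g x) * (x - y) + of_real (g x - g y) * y)"
      by (simp add: half_step_def g_def algebra_simps diff_divide_distrib)
    then have "cmod (half_step b b' F x - half_step b b' F y) \<le>
        b' * (L / b * cmod (x - y)) + ((\<bar>g 0\<bar> + G * \<bar>M\<bar>) + G * \<bar>M\<bar>) * cmod (x - y)"
      using norm_triangle_mono[OF 1 2] by simp
    then show "dist (half_step b b' F x) (half_step b b' F y) \<le> ?C * dist x y"
      by (simp add: dist_norm algebra_simps)
  qed (use b G L0 in auto)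
  then show ?thesis by blast
qed

lemma lipschitz_full_step:
  assumes F: "\<And>M. \<exists>L. L-lipschitz_on (cball 0 M) F" and b: "0 < b" "b < rim" "0 < b'"
  shows "\<exists>L. L-lipschitz_on (cball 0 M) (full_step b b' F)"
proof -
  obtain L where L: "L-lipschitz_on (cball 0 M) (half_step b b' F)"
    using lipschitz_half_step[OF assms] by blast
  obtain L' where L': "L'-lipschitz_on (cball 0 (M + 1)) (half_step b b' F)"
    using lipschitz_half_step[OF assms] by blast
  have 1: "1-lipschitz_on (cball 0 M) (\<lambda>z :: complex. 1 - z)"
    by (auto intro!: lipschitz_onI simp: dist_norm norm_minus_commute)
  have "(\<lambda>z :: complex. 1 - z) ` cball 0 M \<subseteq> cball 0 (M + 1)"
  proof
    fix w assume "w \<in> (\<lambda>z :: complex. 1 - z) ` cball 0 M"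
    then obtain z where "w = 1 - z" "cmod z \<le> M" by auto
    then show "w \<in> cball 0 (M + 1)" using norm_triangle_ineq4[of 1 z] by simp
  qed
  then have "(L' * 1)-lipschitz_on (cball 0 M) (\<lambda>z. half_step b b' F (1 - z))"
    using lipschitz_on_compose2[OF 1 lipschitz_on_subset[OF L']] by blast
  then have "(L + 0 + L' * 1 + 1)-lipschitz_on (cball 0 M) (full_step b b' F)"
    unfolding full_step_def[abs_def] by (intro lipschitz_intros L)
  then show ?thesis by blast
qed

lemma lipschitz_approx:
  assumes "admissible_seq b" "admissible_seq b'"
  shows "\<exists>L. L-lipschitz_on (cball 0 M) (approx k b b')"
  using assms
proof (induction k arbitrary: b b' M)
  case 0
  then show ?case using lipschitz_on_id by auto
next
  case (Suc k)
  show ?case unfolding approx.simps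
    by (intro lipschitz_full_step Suc.IH)
       (use Suc.prems admissible_seqD[of b 0] admissible_seqD[of b' 0] in \<open>auto intro: admissible_seq_shift\<close>)
qed

lemma continuous_approx:
  assumes "admissible_seq b" "admissible_seq b'"
  shows "continuous_on UNIV (approx k b b')"
proof -
  have "continuous (at z) (approx k b b')" for z
  proof -
    obtain L where "L-lipschitz_on (cball 0 (cmod z + 1)) (approx k b b')"
      using lipschitz_approx[OF assms] by blast
    then have "continuous_on (ball 0 (cmod z + 1)) (approx k b b')"
      by (meson ball_subset_cball continuous_on_subset lipschitz_on_continuous_on)
    then show ?thesis by (rule continuous_on_interior) auto
  qed
  then show ?thesis by (simp add: continuous_at_imp_continuous_on)
qed

text \<open>The radial terms do not involve \<open>F\<close> and cancel, leaving two differences of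
  \<open>F\<close>, at the point and at its mirror image, each with the factor \<open>b'\<close>.
  Their sum is a contraction since \<open>2 * b' \<le> 1 - \<delta>\<close>.\<close>

lemma full_step_diff_le:
  assumes "0 < b" "0 < b'" "2 * b' \<le> 1 - \<delta>" "\<And>z. cmod (F z - G z) \<le> e"
  shows "cmod (full_step b b' F z - full_step b b' G z) \<le> (1 - \<delta>) * e"
proof -
  let ?d = "\<lambda>w. of_real b' * (F (w / of_real b) - G (w / of_real b))"
  have d: "cmod (?d w) \<le> b' * e" for w
    unfolding norm_mult using assms by (simp add: mult_left_mono)
  have "0 \<le> e" using assms(4)[of 0] norm_ge_zero order_trans by blast
  have "full_step b b' F z - full_step b b' G z = ?d z - ?d (1 - z)"
    by (simp add: full_step_def half_step_def algebra_simps)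
  then have "cmod (full_step b b' F z - full_step b b' G z) \<le> cmod (?d z) + cmod (?d (1 - z))"
    by (simp only: norm_triangle_ineq4)
  also have "\<dots> \<le> 2 * b' * e" using d[of z] d[of "1 - z"] by simp
  also have "\<dots> \<le> (1 - \<delta>) * e" using assms(3) \<open>0 \<le> e\<close> by (rule mult_right_mono)
  finally show ?thesis .
qed

lemma approx_diff_le:
  assumes "admissible_seq b" "admissible_seq b'"
  shows "cmod (approx (Suc k) b b' z - approx k b b' z) \<le> (1 - \<delta>) ^ k * 2"
  using assms
proof (induction k arbitrary: b b' z)
  case 0
  note b = admissible_seqD[OF 0(1), of 0] admissible_seqD[OF 0(2), of 0]
  let ?h = "\<lambda>w. of_real (radial (b 0) (b' 0) (focal w) - 1) * w"
  have "full_step (b 0) (b' 0) (\<lambda>z. z) z - z = ?h z - ?h (1 - z)"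
    using b by (simp add: full_step_def half_step_def algebra_simps)
  then have "cmod (full_step (b 0) (b' 0) (\<lambda>z. z) z - z) \<le> cmod (?h z) + cmod (?h (1 - z))"
    by (simp only: norm_triangle_ineq4)
  \<comment> \<open>One displacement at \<open>z\<close>, one at the mirror point: the constant
    \<open>2\<close> of the statement.\<close>
  also have "\<dots> \<le> 1 + 1" using b by (intro add_mono radial_displacement) auto
  finally show ?case by simp
next
  case (Suc k)
  note b = admissible_seqD[OF Suc.prems(1), of 0] admissible_seqD[OF Suc.prems(2), of 0]
  have "cmod (full_step (b 0) (b' 0) (approx (Suc k) (shift b) (shift b')) z
      - full_step (b 0) (b' 0) (approx k (shift b) (shift b')) z) \<le> (1 - \<delta>) * ((1 - \<delta>) ^ k * 2)"
    using b by (intro full_step_diff_le Suc.IH admissible_seq_shift Suc.prems) auto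
  then show ?case by (simp only: approx.simps(2)[of "Suc k"] approx.simps(2)[of k b] power_Suc mult.assoc)
qed

text \<open>The limit of the approximations, written as a telescoping series so that the Weierstrass
  test applies to the geometric bound.\<close>

definition cantor_map :: "(nat \<Rightarrow> real) \<Rightarrow> (nat \<Rightarrow> real) \<Rightarrow> complex \<Rightarrow> complex" where
  "cantor_map b b' z = z + (\<Sum>k. approx (Suc k) b b' z - approx k b b' z)"

section \<open>Uniform convergence and the limit map\<close>

lemma uniform_limit_cantor_map:
  assumes "admissible_seq b" "admissible_seq b'"
  shows "uniform_limit UNIV (\<lambda>n. approx n b b') (cantor_map b b') sequentially"
proof -
  have "uniform_limit UNIV (\<lambda>n z. \<Sum>k<n. approx (Suc k) b b' z - approx k b b' z)
      (\<lambda>z. \<Sum>k. approx (Suc k) b b' z - approx k b b' z) sequentially"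
  proof (rule Weierstrass_m_test)
    show "summable (\<lambda>k. (1 - \<delta>) ^ k * 2)"
      using delta by (intro summable_mult2 summable_geometric) auto
  qed (rule approx_diff_le[OF assms])
  then have "uniform_limit UNIV (\<lambda>n z. z + (\<Sum>k<n. approx (Suc k) b b' z - approx k b b' z))
      (\<lambda>z. z + (\<Sum>k. approx (Suc k) b b' z - approx k b b' z)) sequentially"
    by (intro uniform_limit_intros)
  moreover have "z + (\<Sum>k<n. approx (Suc k) b b' z - approx k b b' z) = approx n b b' z" for n z
    using sum_lessThan_telescope[of "\<lambda>k. approx k b b' z" n] by simp
  ultimately show ?thesis by (simp only: cantor_map_def[abs_def])
qed

lemma continuous_cantor_map:
  assumes "admissible_seq b" "admissible_seq b'"
  shows "continuous_on UNIV (cantor_map b b')"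
  by (rule uniform_limit_theorem[OF _ uniform_limit_cantor_map[OF assms]])
     (simp_all add: continuous_approx assms)

lemma cantor_map_limit:
  assumes "admissible_seq b" "admissible_seq b'"
  shows "(\<lambda>n. approx n b b' z) \<longlonglongrightarrow> cantor_map b b' z"
  using tendsto_uniform_limitI[OF uniform_limit_cantor_map[OF assms]] by simp

text \<open>A step evaluates \<open>F\<close> at two points only, so pointwise convergence passes
  through the recursion.\<close>

lemma cantor_map_step:
  assumes "admissible_seq b" "admissible_seq b'"
  shows "cantor_map b b' = full_step (b 0) (b' 0) (cantor_map (shift b) (shift b'))"
proof
  fix z
  have "(\<lambda>n. approx (Suc n) b b' z) \<longlonglongrightarrow> cantor_map b b' z"
    using cantor_map_limit[OF assms] by (rule LIMSEQ_Suc)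
  moreover have "(\<lambda>n. approx (Suc n) b b' z) \<longlonglongrightarrow> full_step (b 0) (b' 0) (cantor_map (shift b) (shift b')) z"
    unfolding approx.simps full_step_def half_step_def
    by (intro tendsto_intros cantor_map_limit admissible_seq_shift assms)
  ultimately show "cantor_map b b' z = full_step (b 0) (b' 0) (cantor_map (shift b) (shift b')) z"
    by (rule LIMSEQ_unique)
qed

lemma fixes_outside_cantor_map:
  assumes "admissible_seq b" "admissible_seq b'"
  shows "fixes_outside (cantor_map b b')"
  unfolding fixes_outside_def
proof (intro allI impI)
  fix z assume "1 \<le> focal z"
  then have "approx n b b' z = z" for n
    using fixes_outside_approx[OF assms(1)] by (simp add: fixes_outside_def)
  then show "cantor_map b b' z = z"
    using cantor_map_limit[OF assms, of z] by (simp add: LIMSEQ_const_iff)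
qed

text \<open>Approximations of equal depth invert each other exactly. Uniform convergence allows
  replacing \<open>approx n b' b\<close> by its limit at the moving point
  \<open>approx n b b' z\<close>, and continuity then settles the inner limit.\<close>

lemma cantor_map_inverse:
  assumes "admissible_seq b" "admissible_seq b'"
  shows "cantor_map b' b (cantor_map b b' z) = z"
proof -
  let ?w = "\<lambda>n. approx n b b' z"
  have "(\<lambda>n. cantor_map b' b (?w n)) \<longlonglongrightarrow> cantor_map b' b (cantor_map b b' z)"
    by (rule continuous_on_tendsto_compose[OF continuous_cantor_map[OF assms(2,1)] cantor_map_limit[OF assms]]) auto
  moreover have "(\<lambda>n. cantor_map b' b (?w n)) \<longlonglongrightarrow> z"
  proof (rule LIMSEQ_I)
    fix e :: real assume "0 < e"
    then have "eventually (\<lambda>n. \<forall>w\<in>UNIV. dist (approx n b' b w) (cantor_map b' b w) < e) sequentially"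
      using uniform_limit_cantor_map[OF assms(2,1)] unfolding uniform_limit_iff by blast
    then obtain N where "\<And>n w. n \<ge> N \<Longrightarrow> dist (approx n b' b w) (cantor_map b' b w) < e"
      unfolding eventually_sequentially by auto
    then have "dist (approx n b' b (?w n)) (cantor_map b' b (?w n)) < e" if "n \<ge> N" for n
      using that by blast
    then have "norm (cantor_map b' b (?w n) - z) < e" if "n \<ge> N" for n
      using that unfolding approx_inverse[OF assms] by (simp add: dist_norm norm_minus_commute)
    then show "\<exists>N. \<forall>n\<ge>N. norm (cantor_map b' b (?w n) - z) < e" by blast
  qed
  ultimately show ?thesis by (rule LIMSEQ_unique)
qed


section \<open>Neighbourhoods of the Cantor set\<close>

text \<open>The preimages of \<open>B\<close> under all compositions of \<open>k\<close> inverse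
  branches \<open>z / b\<close> and \<open>(1 - z) / b\<close>. For a level set of
  \<open>focal\<close> they are elliptic discs around the intervals of stage \<open>k\<close>. The
  closed version serves compactness and complements, the open one neighbourhoods.\<close>

primrec region :: "complex set \<Rightarrow> nat \<Rightarrow> (nat \<Rightarrow> real) \<Rightarrow> complex set" where
  "region B 0 b = B"
| "region B (Suc k) b =
     {z. z / of_real (b 0) \<in> region B k (shift b) \<or> (1 - z) / of_real (b 0) \<in> region B k (shift b)}"

abbreviation closed_region :: "nat \<Rightarrow> (nat \<Rightarrow> real) \<Rightarrow> complex set" where
  "closed_region \<equiv> region {z. focal z \<le> 1}"

abbreviation open_region :: "nat \<Rightarrow> (nat \<Rightarrow> real) \<Rightarrow> complex set" where
  "open_region \<equiv> region {z. focal z < 1}"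

lemma open_open_region: "admissible_seq b \<Longrightarrow> open (open_region k b)"
proof (induction k arbitrary: b)
  case 0
  then show ?case using continuous_focal by (simp add: open_Collect_less continuous_on_const)
next
  case (Suc k)
  have "open_region (Suc k) b = (\<lambda>z. z / of_real (b 0)) -` open_region k (shift b) \<union>
      (\<lambda>z. (1 - z) / of_real (b 0)) -` open_region k (shift b)" by auto
  moreover have "b 0 \<noteq> 0" using admissible_seqD[OF Suc.prems, of 0] by simp
  ultimately show ?case
    using Suc by (auto intro!: open_Un open_vimage continuous_intros simp: admissible_seq_shift)
qed

lemma closed_closed_region: "admissible_seq b \<Longrightarrow> closed (closed_region k b)"
proof (induction k arbitrary: b)
  case 0
  then show ?case using continuous_focal by (simp add: closed_Collect_le continuous_on_const)
next
  case (Suc k)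
  have "closed_region (Suc k) b = (\<lambda>z. z / of_real (b 0)) -` closed_region k (shift b) \<union>
      (\<lambda>z. (1 - z) / of_real (b 0)) -` closed_region k (shift b)" by auto
  moreover have "b 0 \<noteq> 0" using admissible_seqD[OF Suc.prems, of 0] by simp
  ultimately show ?case
    using Suc by (auto intro!: closed_Un closed_vimage continuous_intros simp: admissible_seq_shift)
qed

lemma closed_region_focal_le_1: "admissible_seq b \<Longrightarrow> z \<in> closed_region k b \<Longrightarrow> focal z \<le> 1"
proof (induction k arbitrary: b z)
  case (Suc k)
  note b = admissible_seqD[OF Suc.prems(1), of 0]
  have "focal (z / of_real (b 0)) \<le> 1 \<or> focal ((1 - z) / of_real (b 0)) \<le> 1"
    using Suc.prems Suc.IH[OF admissible_seq_shift[OF Suc.prems(1)]] by auto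
  then have "focal z \<le> 1 \<or> focal (1 - z) \<le> 1"
    using b by (auto simp: focal_divide)
  then show ?case by (simp add: focal_reflect_le_1)
qed simp

lemma closed_region_Suc_subset: "admissible_seq b \<Longrightarrow> closed_region (Suc k) b \<subseteq> closed_region k b"
proof (induction k arbitrary: b)
  case 0
  show ?case
  proof
    fix z assume "z \<in> closed_region (Suc 0) b"
    then have "focal z \<le> 1" by (rule closed_region_focal_le_1[OF 0])
    then show "z \<in> closed_region 0 b" by simp
  qed
next
  case (Suc k)
  show ?case
  proof
    fix z assume "z \<in> closed_region (Suc (Suc k)) b"
    then show "z \<in> closed_region (Suc k) b"
      unfolding region.simps(2)[of _ "Suc k"] region.simps(2)[of _ k b]
      using subsetD[OF Suc.IH[OF admissible_seq_shift[OF Suc.prems]]] by (simp del: region.simps) blast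
  qed
qed

lemma closed_region_antimono: "admissible_seq b \<Longrightarrow> m \<le> n \<Longrightarrow> closed_region n b \<subseteq> closed_region m b"
  by (rule lift_Suc_antimono_le[of "\<lambda>k. closed_region k b"]) (rule closed_region_Suc_subset)

text \<open>Being outside the region of depth \<open>Suc k\<close> says exactly that the two points
  where the step evaluates the inner map are outside the region of depth \<open>k\<close>; at depth
  \<open>0\<close> the limit is the identity.\<close>

lemma cantor_map_eq_approx:
  assumes "admissible_seq b" "admissible_seq b'" "z \<notin> closed_region k b"
  shows "cantor_map b b' z = approx k b b' z"
  using assms
proof (induction k arbitrary: b b' z)
  case 0
  then show ?case using fixes_outside_cantor_map[OF 0(1,2)] by (simp add: fixes_outside_def)
next
  case (Suc k)
  then show ?case
    by (simp add: cantor_map_step[OF Suc.prems(1,2)] full_step_def half_step_def admissible_seq_shift)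
qed

text \<open>Each level scales heights by a factor below \<open>1 / 2\<close>, so the regions shrink
  to the real axis.\<close>

lemma closed_region_Im:
  assumes "admissible_seq b" "z \<in> closed_region k b"
  shows "\<bar>Im z\<bar> \<le> 2 * (1 / 2) ^ k"
  using assms
proof (induction k arbitrary: b z)
  case 0
  then have "cmod z + cmod (1 - z) \<le> 1 + \<delta>" by (simp add: focal_le_1_iff)
  then show ?case using abs_Im_le_cmod[of z] norm_ge_zero[of "1 - z"] delta unfolding power_0 by linarith
next
  case (Suc k)
  note b = admissible_seqD[OF Suc.prems(1), of 0]
  have "\<bar>Im (z / of_real (b 0))\<bar> \<le> 2 * (1 / 2) ^ k"
    using Suc.prems Suc.IH[OF admissible_seq_shift[OF Suc.prems(1)], of "z / of_real (b 0)"]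
      Suc.IH[OF admissible_seq_shift[OF Suc.prems(1)], of "(1 - z) / of_real (b 0)"] by auto
  then have "\<bar>Im z\<bar> \<le> b 0 * (2 * (1 / 2) ^ k)" using b by (simp add: field_simps)
  also have "\<dots> \<le> 1 / 2 * (2 * (1 / 2) ^ k)" using b delta by (intro mult_right_mono) auto
  finally show ?case by simp
qed

lemma eventually_outside_region:
  assumes "admissible_seq b" "Im z \<noteq> 0"
  shows "\<exists>k. z \<notin> closed_region k b"
proof -
  obtain k where "(1 / 2) ^ k < \<bar>Im z\<bar> / 2"
  proof -
    have "0 < \<bar>Im z\<bar> / 2" using assms(2) by simp
    then show thesis using real_arch_pow_inv[of "\<bar>Im z\<bar> / 2" "1 / 2"] that by fastforce
  qed
  then have "\<not> \<bar>Im z\<bar> \<le> 2 * (1 / 2) ^ k" by linarith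
  then show ?thesis using closed_region_Im[OF assms(1), of z k] by blast
qed


text \<open>A level replaces the real trace by two copies scaled by \<open>b 0\<close>, so lengths
  shrink by \<open>2 * b 0 \<le> 1 - \<delta>\<close>; the constant \<open>4\<close> is the length
  of \<open>[-2, 2]\<close>.\<close>

lemma emeasure_real_region:
  assumes "admissible_seq b"
  shows "emeasure lebesgue {x. complex_of_real x \<in> closed_region k b} \<le> ennreal (4 * (1 - \<delta>) ^ k)"
  using assms
proof (induction k arbitrary: b)
  case 0
  have "{x. complex_of_real x \<in> closed_region 0 b} \<subseteq> {-2..2}"
  proof
    fix x assume "x \<in> {x. complex_of_real x \<in> closed_region 0 b}"
    then have "\<bar>x\<bar> + cmod (1 - of_real x) \<le> 1 + \<delta>" by (simp add: focal_le_1_iff)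
    then have "\<bar>x\<bar> \<le> 2" using norm_ge_zero[of "1 - complex_of_real x"] delta by linarith
    then show "x \<in> {-2..2}" by auto
  qed
  then have "emeasure lebesgue {x. complex_of_real x \<in> closed_region 0 b} \<le> emeasure lebesgue {-2..2::real}"
    by (rule emeasure_mono) simp
  also have "\<dots> = ennreal 4" by simp
  finally show ?case by simp
next
  case (Suc k)
  note b = admissible_seqD[OF Suc.prems, of 0]
  let ?X = "{x. complex_of_real x \<in> closed_region k (shift b)}"
  have clX: "closed ?X"
    using closed_vimage[OF closed_closed_region[OF admissible_seq_shift[OF Suc.prems]] continuous_on_of_real[OF continuous_on_id]]
    by (simp add: vimage_def)
  have aff: "emeasure lebesgue ((\<lambda>x. m *\<^sub>R x + d) ` ?X) = ennreal \<bar>m\<bar> * emeasure lebesgue ?X" for m d :: real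
    using emeasure_lebesgue_affine[of m d ?X] by simp
  have meas: "(\<lambda>x. m *\<^sub>R x + d) ` ?X \<in> sets lebesgue" if "m \<noteq> 0" for m d :: real
  proof -
    have "closed ((\<lambda>x. d + x) ` ((\<lambda>x. m *\<^sub>R x) ` ?X))"
      by (intro closed_translation closed_scaling clX)
    then show ?thesis by (simp add: image_image add.commute)
  qed
  have "{x. complex_of_real x \<in> closed_region (Suc k) b} \<subseteq>
      (\<lambda>x. b 0 *\<^sub>R x + 0) ` ?X \<union> (\<lambda>x. (- b 0) *\<^sub>R x + 1) ` ?X"
  proof
    fix x assume "x \<in> {x. complex_of_real x \<in> closed_region (Suc k) b}"
    then have "x / b 0 \<in> ?X \<or> (1 - x) / b 0 \<in> ?X" by simp
    then show "x \<in> (\<lambda>x. b 0 *\<^sub>R x + 0) ` ?X \<union> (\<lambda>x. (- b 0) *\<^sub>R x + 1) ` ?X"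
    proof
      assume "x / b 0 \<in> ?X"
      then have "x \<in> (\<lambda>x. b 0 *\<^sub>R x + 0) ` ?X" using b by (intro image_eqI[of _ _ "x / b 0"]) auto
      then show ?thesis ..
    next
      assume "(1 - x) / b 0 \<in> ?X"
      then have "x \<in> (\<lambda>x. (- b 0) *\<^sub>R x + 1) ` ?X" using b by (intro image_eqI[of _ _ "(1 - x) / b 0"]) auto
      then show ?thesis ..
    qed
  qed
  then have "emeasure lebesgue {x. complex_of_real x \<in> closed_region (Suc k) b} \<le>
      emeasure lebesgue ((\<lambda>x. b 0 *\<^sub>R x + 0) ` ?X \<union> (\<lambda>x. (- b 0) *\<^sub>R x + 1) ` ?X)"
    using b by (intro emeasure_mono sets.Un meas) auto
  also have "\<dots> \<le> ennreal (b 0) * emeasure lebesgue ?X + ennreal (b 0) * emeasure lebesgue ?X"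
    by (rule order_trans[OF emeasure_subadditive[OF meas meas]]) (use b in \<open>simp_all only: aff, simp_all\<close>)
  also have "\<dots> \<le> ennreal (b 0) * ennreal (4 * (1 - \<delta>) ^ k) + ennreal (b 0) * ennreal (4 * (1 - \<delta>) ^ k)"
    using Suc.IH[OF admissible_seq_shift[OF Suc.prems]] by (intro add_mono mult_left_mono) auto
  also have "\<dots> = ennreal ((2 * b 0) * (4 * (1 - \<delta>) ^ k))"
    using b delta by (simp add: ennreal_mult[symmetric] ennreal_plus[symmetric] del: ennreal_plus)
  also have "\<dots> \<le> ennreal ((1 - \<delta>) * (4 * (1 - \<delta>) ^ k))"
    using b delta by (intro ennreal_leI mult_right_mono) auto
  finally show ?case by (simp add: mult_ac)
qed

lemma AE_outside_region:
  assumes "admissible_seq b"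
  shows "AE x in lborel. \<exists>k. complex_of_real x \<notin> closed_region k b"
proof -
  define X where "X k = {x. complex_of_real x \<in> closed_region k b}" for k
  have cl: "closed (X k)" for k
    unfolding X_def using closed_vimage[OF closed_closed_region[OF assms] continuous_on_of_real[OF continuous_on_id]]
    by (simp add: vimage_def)
  have "closed (\<Inter>k. X k)" by (rule closed_INT) (simp add: cl)
  then have N: "(\<Inter>k. X k) \<in> sets lborel" by simp
  have "emeasure lborel (\<Inter>k. X k) \<le> ennreal (4 * (1 - \<delta>) ^ k)" for k
  proof -
    have "emeasure lborel (\<Inter>k. X k) \<le> emeasure lborel (X k)"
      by (rule emeasure_mono[OF INT_lower[OF UNIV_I]]) (simp add: cl)
    also have "\<dots> = emeasure lebesgue (X k)" by (simp add: cl)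
    also have "\<dots> \<le> ennreal (4 * (1 - \<delta>) ^ k)"
      unfolding X_def by (rule emeasure_real_region[OF assms])
    finally show ?thesis .
  qed
  moreover have "(\<lambda>k. ennreal (4 * (1 - \<delta>) ^ k)) \<longlonglongrightarrow> ennreal (4 * 0)"
    using delta by (intro tendsto_ennrealI tendsto_mult_left LIMSEQ_power_zero) auto
  ultimately have "emeasure lborel (\<Inter>k. X k) \<le> ennreal (4 * 0)"
    using LIMSEQ_le_const by blast
  then have "(\<Inter>k. X k) \<in> null_sets lborel" using N by (simp add: null_setsI)
  then show ?thesis by (rule AE_I') (auto simp: X_def)
qed


text \<open>By compactness, a curve that avoids the intersection of the nested closed regions avoids
  one of them. There the limit agrees with a finite approximation, which is Lipschitz on
  balls.\<close>

lemma absolutely_continuous_cantor_map: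
  assumes b: "admissible_seq b" "admissible_seq b'"
    and \<gamma>: "1-lipschitz_on {s..t} \<gamma>" and out: "\<And>x. x \<in> {s..t} \<Longrightarrow> \<exists>k. \<gamma> x \<notin> closed_region k b"
  shows "absolutely_continuous_segment s t (\<lambda>x. cantor_map b b' (\<gamma> x))"
proof -
  have comp: "compact (\<gamma> ` {s..t})"
    using \<gamma> by (intro compact_continuous_image lipschitz_on_continuous_on) auto
  have "\<exists>k. \<gamma> ` {s..t} \<inter> closed_region k b = {}"
  proof (rule ccontr)
    assume "\<not> ?thesis"
    then have "(\<Inter>k. \<gamma> ` {s..t} \<inter> closed_region k b) \<noteq> {}"
      using comp closed_closed_region[OF b(1)] closed_region_antimono[OF b(1)]
      by (intro compact_nest compact_Int_closed Int_mono order_refl) auto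
    then obtain w where w: "\<And>k. w \<in> \<gamma> ` {s..t} \<inter> closed_region k b" by blast
    then obtain x where "x \<in> {s..t}" "w = \<gamma> x" by blast
    then show False using out w by blast
  qed
  then obtain k where k: "\<gamma> ` {s..t} \<inter> closed_region k b = {}" by blast
  obtain M where M: "\<gamma> ` {s..t} \<subseteq> cball 0 M"
    using bounded_subset_ballD[OF compact_imp_bounded[OF comp], of 0] ball_subset_cball by blast
  obtain L where "L-lipschitz_on (cball 0 M) (approx k b b')"
    using lipschitz_approx[OF b] by blast
  then have "(L * 1)-lipschitz_on {s..t} (\<lambda>x. approx k b b' (\<gamma> x))"
    by (rule lipschitz_on_compose2[OF \<gamma> lipschitz_on_subset[OF _ M]])
  then have "absolutely_continuous_segment s t (\<lambda>x. approx k b b' (\<gamma> x))"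
    by (rule lipschitz_imp_absolutely_continuous)
  then show ?thesis
    by (rule absolutely_continuous_segment_cong) (use k cantor_map_eq_approx[OF b, of _ k] in \<open>simp add: disjoint_iff\<close>)
qed

text \<open>Horizontal lines other than the real axis leave the regions by height. A vertical line
  can fail only at its real point, and the bad real points form a null set.\<close>

lemma ACL_on_cantor_map:
  assumes b: "admissible_seq b" "admissible_seq b'"
  shows "ACL_on UNIV (cantor_map b b')"
  unfolding ACL_on_def
proof (intro allI impI conjI)
  fix s t c d :: real
  have lip: "1-lipschitz_on X (\<lambda>x. Complex x y)" "1-lipschitz_on X (Complex y)" for X y
    by (auto intro!: lipschitz_onI simp: dist_complex_def cmod_def dist_real_def)
  show "AE y in lborel. c \<le> y \<and> y \<le> d \<longrightarrow> absolutely_continuous_segment s t (\<lambda>x. cantor_map b b' (Complex x y))"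
    using AE_lborel_neq[of 0]
  proof eventually_elim
    case (elim y)
    have "\<exists>k. Complex x y \<notin> closed_region k b" for x
      by (rule eventually_outside_region[OF b(1)]) (simp add: elim)
    then show ?case using absolutely_continuous_cantor_map[OF b lip(1)] by simp
  qed
  show "AE x in lborel. s \<le> x \<and> x \<le> t \<longrightarrow> absolutely_continuous_segment c d (\<lambda>y. cantor_map b b' (Complex x y))"
    using AE_outside_region[OF b(1)]
  proof eventually_elim
    case (elim x)
    have "\<exists>k. Complex x y \<notin> closed_region k b" for y
      using elim eventually_outside_region[OF b(1), of "Complex x y"]
      by (cases "y = 0") (auto simp: complex_of_real_def)
    then show ?case using absolutely_continuous_cantor_map[OF b lip(2)] by simp
  qed
qed

end

section \<open>Dilatation\<close>

text \<open>Moves a constant factor into the argument, so that it ends up in the exponent of the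
  dilatation.\<close>

lemma sinh_mult_ge:
  fixes c x :: real
  assumes "1 \<le> c" "0 \<le> x"
  shows "c * sinh x \<le> sinh (c * x)"
proof -
  let ?h = "\<lambda>t. sinh (c * t) - c * sinh t"
  have "?h 0 \<le> ?h x"
  proof (rule DERIV_nonneg_imp_nondecreasing[OF assms(2)])
    fix t :: real assume t: "0 \<le> t" "t \<le> x"
    have "1 * t \<le> c * t" using assms(1) t(1) by (rule mult_right_mono)
    then have "cosh t \<le> cosh (c * t)" using t assms by (simp add: cosh_real_nonneg_le_iff)
    then have "0 \<le> c * cosh (c * t) - c * cosh t" using assms by simp
    moreover have "(?h has_real_derivative c * cosh (c * t) - c * cosh t) (at t)"
      by (auto intro!: derivative_eq_intros)
    ultimately show "\<exists>y. (?h has_real_derivative y) (at t) \<and> 0 \<le> y" by blast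
  qed
  then show ?thesis by simp
qed

text \<open>With \<open>\<alpha> = exp x\<close> this turns
  \<open>(\<alpha> - 1)\<^sup>2 / \<alpha>\<close> into an even function of
  \<open>ln \<alpha>\<close>.\<close>

lemma sinh_half_square: "(2 * sinh (x / 2))\<^sup>2 = (exp x - 1)\<^sup>2 / exp (x :: real)"
proof -
  define E where "E = exp (x / 2)"
  have E: "0 < E" "exp x = E * E" by (simp_all add: E_def flip: exp_add)
  have sh: "2 * sinh (x / 2) = E - 1 / E"
    by (simp add: sinh_field_def exp_minus E_def inverse_eq_divide)
  show ?thesis
    unfolding E(2) sh
    using E(1) by (simp add: power2_eq_square field_simps)
qed

text \<open>The dilatation of the shear \<open>(s, \<theta>) \<mapsto> (\<alpha> s + (\<alpha> - 1) e \<theta>, \<theta>)\<close>, which is the radial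
  stretch in logarithmic coordinates, is governed by \<open>(\<alpha> - 1)\<^sup>2 (1 + e\<^sup>2) / \<alpha>\<close>.\<close>

lemma shear_dilatation:
  fixes \<alpha> e c X :: real
  assumes "0 < \<alpha>" "1 \<le> c" "1 + e\<^sup>2 \<le> c\<^sup>2" "c * \<bar>ln \<alpha>\<bar> \<le> X"
  shows "(\<alpha> - 1)\<^sup>2 * (1 + e\<^sup>2) * exp X \<le> (exp X - 1)\<^sup>2 * \<alpha>"
proof -
  have "(\<alpha> - 1)\<^sup>2 / \<alpha> = (2 * sinh (\<bar>ln \<alpha>\<bar> / 2))\<^sup>2"
  proof (cases "1 \<le> \<alpha>")
    case True
    then show ?thesis by (simp only: sinh_half_square) simp
  next
    case False
    then show ?thesis using assms(1)
      by (simp only: sinh_half_square) (simp add: exp_minus power2_eq_square field_simps)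
  qed
  then have "(\<alpha> - 1)\<^sup>2 / \<alpha> * (1 + e\<^sup>2) \<le> (2 * sinh (\<bar>ln \<alpha>\<bar> / 2))\<^sup>2 * c\<^sup>2"
    using assms(3) by (simp only:) (rule mult_left_mono, simp_all)
  also have "\<dots> = (2 * (c * sinh (\<bar>ln \<alpha>\<bar> / 2)))\<^sup>2" by (simp add: power_mult_distrib)
  also have "\<dots> \<le> (2 * sinh (X / 2))\<^sup>2"
  proof (rule power_mono)
    have "c * sinh (\<bar>ln \<alpha>\<bar> / 2) \<le> sinh (c * (\<bar>ln \<alpha>\<bar> / 2))" using assms by (intro sinh_mult_ge) auto
    also have "\<dots> \<le> sinh (X / 2)" using assms(4) by simp
    finally show "2 * (c * sinh (\<bar>ln \<alpha>\<bar> / 2)) \<le> 2 * sinh (X / 2)" by simp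
  qed (use assms in simp)
  also have "\<dots> = (exp X - 1)\<^sup>2 / exp X" by (rule sinh_half_square)
  finally show ?thesis using assms(1) by (simp add: field_simps)
qed

text \<open>Up to a common factor the two roots are the moduli of the complex derivatives of the
  shear with \<open>\<alpha> = 1 + \<kappa>\<close>. Their squares differ by
  \<open>4 * (1 + \<kappa>)\<close>, so after squaring the claim becomes the hypothesis multiplied
  by \<open>4\<close>.\<close>

lemma dilatation_le_of_shear:
  fixes \<kappa> e K :: real
  assumes "1 \<le> K" "\<kappa>\<^sup>2 * (1 + e\<^sup>2) * K \<le> (K - 1)\<^sup>2 * (1 + \<kappa>)"
  shows "sqrt (\<kappa>\<^sup>2 * (1 + e\<^sup>2)) \<le> (K - 1) / (K + 1) * sqrt ((2 + \<kappa>)\<^sup>2 + (\<kappa> * e)\<^sup>2)"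
proof -
  have eq: "(K - 1)\<^sup>2 * ((2 + \<kappa>)\<^sup>2 + (\<kappa> * e)\<^sup>2) - (K + 1)\<^sup>2 * (\<kappa>\<^sup>2 * (1 + e\<^sup>2))
      = 4 * ((K - 1)\<^sup>2 * (1 + \<kappa>) - \<kappa>\<^sup>2 * (1 + e\<^sup>2) * K)"
    by (simp add: power2_eq_square algebra_simps)
  have "0 \<le> 4 * ((K - 1)\<^sup>2 * (1 + \<kappa>) - \<kappa>\<^sup>2 * (1 + e\<^sup>2) * K)"
    using assms(2) by simp
  then have "(K + 1)\<^sup>2 * (\<kappa>\<^sup>2 * (1 + e\<^sup>2)) \<le> (K - 1)\<^sup>2 * ((2 + \<kappa>)\<^sup>2 + (\<kappa> * e)\<^sup>2)"
    unfolding eq[symmetric] by (rule iffD1[OF diff_ge_0_iff_ge])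
  then have "sqrt ((K + 1)\<^sup>2 * (\<kappa>\<^sup>2 * (1 + e\<^sup>2))) \<le> sqrt ((K - 1)\<^sup>2 * ((2 + \<kappa>)\<^sup>2 + (\<kappa> * e)\<^sup>2))"
    by (rule real_sqrt_le_mono)
  then have "(K + 1) * sqrt (\<kappa>\<^sup>2 * (1 + e\<^sup>2)) \<le> (K - 1) * sqrt ((2 + \<kappa>)\<^sup>2 + (\<kappa> * e)\<^sup>2)"
    using assms(1) by (simp only: real_sqrt_mult real_sqrt_abs abs_of_nonneg)
  then show ?thesis using assms(1) by (simp add: field_simps)
qed

section \<open>Dilatation of a step and of the limit map\<close>

context thick
begin

text \<open>The factor \<open>2 / \<delta>\<close> reflects the thickness of the ring
  (\<open>radial_exponent\<close>), the factor \<open>1 + 1 / \<delta>\<close> the slant of the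
  ellipses against the rays (\<open>dilatation_power_stretch\<close>).\<close>

definition dil_const :: real where
  "dil_const = 2 / \<delta> * (1 + 1 / \<delta>)"

lemma dil_const_pos: "0 < dil_const"
  using delta by (simp add: dil_const_def add_pos_pos)

text \<open>The number \<open>1 + \<kappa>\<close> is the quotient \<open>A' / A\<close> of the
  logarithmic thicknesses of the two rings. Both are at least \<open>\<delta> / 2\<close>, and their
  difference is \<open>ln (b' / b)\<close> up to sign, so \<open>ln x \<le> x - 1\<close> gives the
  bound.\<close>

lemma radial_exponent:
  assumes "admissible b" "admissible b'"
  defines "\<kappa> \<equiv> ln (b' / b) / ln (b / rim)"
  shows "0 < 1 + \<kappa>" "\<bar>ln (1 + \<kappa>)\<bar> \<le> 2 / \<delta> * \<bar>ln (b' / b)\<bar>"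
proof -
  note b = admissibleD[OF assms(1)] admissibleD[OF assms(2)] rim_bounds
  define A where "A = ln (rim / b)"
  define A' where "A' = ln (rim / b')"
  have A: "\<delta> / 2 \<le> A" "\<delta> / 2 \<le> A'" using ln_rim_div_ge assms by (auto simp: A_def A'_def)
  then have pos: "0 < A" "0 < A'" using delta by auto
  have lnb: "ln (b' / b) = A - A'" "ln (b / rim) = - A" using b by (auto simp: A_def A'_def ln_div)
  have eq: "1 + \<kappa> = A' / A" using pos by (simp add: \<kappa>_def lnb field_simps)
  show "0 < 1 + \<kappa>" using eq pos by simp
  have le: "ln (s / t) \<le> 2 / \<delta> * \<bar>s - t\<bar>" if "0 < s" "\<delta> / 2 \<le> t" for s t
  proof -
    have t: "0 < t" using that delta by simp
    have "ln (s / t) \<le> s / t - 1" using that t by (intro ln_le_minus_one) simp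
    also have "\<dots> \<le> \<bar>s - t\<bar> / t" proof -
      have "s / t - 1 = (s - t) / t" using t by (simp add: diff_divide_distrib)
      also have "\<dots> \<le> \<bar>s - t\<bar> / t" using t by (intro divide_right_mono) auto
      finally show ?thesis .
    qed
    also have "\<dots> \<le> \<bar>s - t\<bar> / (\<delta> / 2)" using that delta by (intro divide_left_mono) auto
    finally show ?thesis by (simp add: field_simps)
  qed
  have "ln (1 + \<kappa>) \<le> 2 / \<delta> * \<bar>A' - A\<bar>" unfolding eq by (rule le[OF pos(2) A(1)])
  moreover have "- ln (1 + \<kappa>) \<le> 2 / \<delta> * \<bar>A - A'\<bar>"
    using le[OF pos(1) A(2)] pos by (simp add: eq ln_div)
  ultimately show "\<bar>ln (1 + \<kappa>)\<bar> \<le> 2 / \<delta> * \<bar>ln (b' / b)\<bar>"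
    by (simp add: lnb abs_minus_commute[of A' A] abs_le_iff)
qed

lemma focal_has_derivative_Re:
  assumes "z \<noteq> 0"
  shows "((\<lambda>x. focal (Complex x (Im z))) has_real_derivative
    2 / (\<delta> * (2 + \<delta>)) * ((1 + \<delta>) * Re z / cmod z - 1)) (at (Re z))"
proof -
  have "0 < (Re z)\<^sup>2 + (Im z)\<^sup>2" using assms by (simp add: complex_neq_0)
  then have "((\<lambda>x. cmod (Complex x (Im z))) has_real_derivative Re z / cmod z) (at (Re z))"
    unfolding cmod_def by (auto intro!: derivative_eq_intros simp: field_simps)
  from DERIV_cmult[OF DERIV_diff[OF DERIV_cmult[OF this, of "1 + \<delta>"] DERIV_ident], of "2 / (\<delta> * (2 + \<delta>))"]
  show ?thesis by (simp add: focal_def)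
qed

lemma focal_has_derivative_Im:
  assumes "z \<noteq> 0"
  shows "((\<lambda>y. focal (Complex (Re z) y)) has_real_derivative
    2 / (\<delta> * (2 + \<delta>)) * ((1 + \<delta>) * Im z / cmod z)) (at (Im z))"
proof -
  have "0 < (Re z)\<^sup>2 + (Im z)\<^sup>2" using assms by (simp add: complex_neq_0)
  then have "((\<lambda>y. cmod (Complex (Re z) y)) has_real_derivative Im z / cmod z) (at (Im z))"
    unfolding cmod_def by (auto intro!: derivative_eq_intros simp: field_simps)
  from DERIV_cmult[OF DERIV_diff[OF DERIV_cmult[OF this, of "1 + \<delta>"] DERIV_const[of "Re z"]], of "2 / (\<delta> * (2 + \<delta>))"]
  show ?thesis by (simp add: focal_def)
qed

lemma powr_quotient_derivative:
  assumes "(g has_real_derivative g') (at x)" "0 < g x"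
  shows "((\<lambda>x. (g x / rim) powr \<kappa>) has_real_derivative (g x / rim) powr \<kappa> * (\<kappa> * (g' / g x))) (at x)"
proof -
  have "((\<lambda>x. (g x / rim) powr \<kappa>) has_real_derivative \<kappa> * (g x / rim) powr (\<kappa> - 1) * (g' / rim)) (at x)"
    using assms rim_bounds
    by (auto intro!: derivative_eq_intros simp: powr_diff field_simps)
  moreover have "\<kappa> * (g x / rim) powr (\<kappa> - 1) * (g' / rim) = (g x / rim) powr \<kappa> * (\<kappa> * (g' / g x))"
    using assms(2) rim_bounds by (simp add: powr_diff field_simps)
  ultimately show ?thesis by simp
qed

text \<open>In logarithmic polar coordinates \<open>(s, \<theta>)\<close>,
  \<open>ln (focal z)\<close> is \<open>s\<close> plus a function of \<open>\<theta>\<close>, so the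
  map is a shear with factor \<open>1 + \<kappa>\<close> in \<open>s\<close>, up to a
  translation.\<close>

lemma dilatation_power_stretch:
  assumes "z \<noteq> 0" "0 < 1 + \<kappa>" "(1 + 1 / \<delta>) * \<bar>ln (1 + \<kappa>)\<bar> \<le> X"
  shows "dilatation_le_at (exp X) (\<lambda>w. of_real ((focal w / rim) powr \<kappa>) * w) z"
proof -
  define C where "C = 2 / (\<delta> * (2 + \<delta>))"
  define n where "n = (1 + \<delta>) * cmod z - Re z"
  define p where "p = (1 + \<delta>) * Re z / cmod z - 1"
  define r where "r = (1 + \<delta>) * Im z / cmod z"
  define P where "P = (focal z / rim) powr \<kappa>"
  \<comment> \<open>The derivative of \<open>ln (1 + \<delta> - cos \<theta>)\<close>, the angular
    part of \<open>ln (focal z)\<close>.\<close>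
  define e where "e = Im z / n"
  have C: "0 < C" using delta by (simp add: C_def)
  have fz: "focal z = C * n" by (simp add: focal_def C_def n_def)
  have fpos: "0 < focal z" using assms(1) by (rule focal_pos)
  then have npos: "0 < n" using fz C by (simp add: zero_less_mult_iff)
  have Ppos: "0 < P" using fpos rim_bounds by (simp add: P_def)
  have r0: "0 < cmod z" using assms(1) by simp
  have dx: "((\<lambda>x. (focal (Complex x (Im z)) / rim) powr \<kappa>) has_real_derivative P * (\<kappa> * (p / n))) (at (Re z))"
    using powr_quotient_derivative[OF focal_has_derivative_Re[OF assms(1), folded p_def C_def], of \<kappa>] fpos C
    by (simp add: P_def fz)
  have dy: "((\<lambda>y. (focal (Complex (Re z) y) / rim) powr \<kappa>) has_real_derivative P * (\<kappa> * (r / n))) (at (Im z))"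
    using powr_quotient_derivative[OF focal_has_derivative_Im[OF assms(1), folded r_def C_def], of \<kappa>] fpos C
    by (simp add: P_def fz)
  have vx: "((\<lambda>x. Complex x (Im z)) has_vector_derivative 1) (at (Re z))"
    and vy: "((\<lambda>y. Complex (Re z) y) has_vector_derivative \<i>) (at (Im z))"
    by (auto simp: Complex_eq scaleR_conv_of_real has_vector_derivative_def intro!: derivative_eq_intros)
  define u where "u = of_real P * (1 + of_real (\<kappa> * (p / n)) * z)"
  define v where "v = of_real P * (\<i> + of_real (\<kappa> * (r / n)) * z)"
  have U: "((\<lambda>x. of_real ((focal (Complex x (Im z)) / rim) powr \<kappa>) * Complex x (Im z)) has_vector_derivative u) (at (Re z))"
    by (rule has_vector_derivative_eq_rhs[OF has_vector_derivative_mult[OF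
          has_vector_derivative_of_real[OF dx] vx]])
       (simp add: u_def P_def algebra_simps)
  have V: "((\<lambda>y. of_real ((focal (Complex (Re z) y) / rim) powr \<kappa>) * Complex (Re z) y) has_vector_derivative v) (at (Im z))"
    by (rule has_vector_derivative_eq_rhs[OF has_vector_derivative_mult[OF
          has_vector_derivative_of_real[OF dy] vy]])
       (simp add: v_def P_def algebra_simps)
  have zz: "(cmod z)\<^sup>2 = (Re z)\<^sup>2 + (Im z)\<^sup>2" by (rule cmod_power2)
  \<comment> \<open>The pair \<open>(p, r)\<close> is the gradient of \<open>n\<close>; the identity
    compares its length with the slope \<open>e\<close>.\<close>
  have norm1: "(cmod z)\<^sup>2 * (p\<^sup>2 + r\<^sup>2) = n\<^sup>2 + (Im z)\<^sup>2"
  proof -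
    have "cmod z * p = (1 + \<delta>) * Re z - cmod z" "cmod z * r = (1 + \<delta>) * Im z"
      using r0 by (simp_all add: p_def r_def field_simps)
    then have "(cmod z)\<^sup>2 * (p\<^sup>2 + r\<^sup>2) = ((1 + \<delta>) * Re z - cmod z)\<^sup>2 + ((1 + \<delta>) * Im z)\<^sup>2"
      by (simp only: distrib_left flip: power_mult_distrib)
    also have "\<dots> = (1 + \<delta>)\<^sup>2 * ((Re z)\<^sup>2 + (Im z)\<^sup>2) - 2 * (1 + \<delta>) * Re z * cmod z + (cmod z)\<^sup>2"
      by (simp add: power2_eq_square algebra_simps)
    also have "\<dots> = (1 + \<delta>)\<^sup>2 * (cmod z)\<^sup>2 - 2 * (1 + \<delta>) * Re z * cmod z + (Re z)\<^sup>2 + (Im z)\<^sup>2"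
      by (simp only: zz)
    also have "\<dots> = n\<^sup>2 + (Im z)\<^sup>2" by (simp add: n_def power2_eq_square algebra_simps)
    finally show ?thesis .
  qed
  \<comment> \<open>The contributions \<open>1\<close> and \<open>\<i> * \<i>\<close> of the factor
    \<open>z\<close> cancel; only the derivative of the radial factor remains.\<close>
  have plus: "u + \<i> * v = of_real (P * \<kappa> / n) * (z * Complex p r)"
    using npos by (simp add: u_def v_def complex_eq_iff field_simps)
  have "cmod (u + \<i> * v) = P * sqrt (\<kappa>\<^sup>2 * (1 + e\<^sup>2))"
  proof -
    have "cmod (z * Complex p r) = sqrt ((cmod z)\<^sup>2 * (p\<^sup>2 + r\<^sup>2))"
      by (simp add: norm_mult real_sqrt_mult) (simp add: cmod_def)
    also have "\<dots> = sqrt (n\<^sup>2 * (1 + e\<^sup>2))" unfolding norm1 using npos by (simp add: e_def field_simps)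
    also have "\<dots> = n * sqrt (1 + e\<^sup>2)" using npos by (simp add: real_sqrt_mult)
    finally have "cmod (u + \<i> * v) = \<bar>P * \<kappa> / n\<bar> * (n * sqrt (1 + e\<^sup>2))"
      by (simp only: plus norm_mult[of "of_real _"] norm_of_real)
    also have "\<dots> = P * (\<bar>\<kappa>\<bar> * sqrt (1 + e\<^sup>2))"
      using npos Ppos by (simp add: abs_mult)
    also have "\<dots> = P * sqrt (\<kappa>\<^sup>2 * (1 + e\<^sup>2))" by (simp add: real_sqrt_mult)
    finally show ?thesis .
  qed
  moreover have "cmod (u - \<i> * v) = P * sqrt ((2 + \<kappa>)\<^sup>2 + (\<kappa> * e)\<^sup>2)"
  proof -
    have "z * Complex p (- r) = of_real n - \<i> * of_real (Im z)"
    proof -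
      have "(Re z * Re z + Im z * Im z) / cmod z = cmod z"
        using zz r0 by (simp add: power2_eq_square field_simps)
      then have "(1 + \<delta>) * ((Re z * Re z + Im z * Im z) / cmod z) = (1 + \<delta>) * cmod z" by simp
      then show ?thesis
        by (simp add: complex_eq_iff n_def p_def r_def algebra_simps add_divide_distrib)
    qed
    moreover have "u - \<i> * v = of_real P * (2 + of_real (\<kappa> / n) * (z * Complex p (- r)))"
      by (simp add: u_def v_def complex_eq_iff algebra_simps diff_divide_distrib add_divide_distrib)
    ultimately have "u - \<i> * v = of_real P * Complex (2 + \<kappa>) (- (\<kappa> * e))"
      using npos by (simp add: complex_eq_iff e_def)
    then show ?thesis using Ppos by (simp only: norm_mult norm_of_real complex_norm) simp
  qed
  moreover have "sqrt (\<kappa>\<^sup>2 * (1 + e\<^sup>2)) \<le> (exp X - 1) / (exp X + 1) * sqrt ((2 + \<kappa>)\<^sup>2 + (\<kappa> * e)\<^sup>2)"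
  proof (rule dilatation_le_of_shear)
    have c: "1 \<le> 1 + 1 / \<delta>" using delta by simp
    have "0 \<le> (1 + 1 / \<delta>) * \<bar>ln (1 + \<kappa>)\<bar>" using c by simp
    then show "1 \<le> exp X" using assms(3) by simp
    \<comment> \<open>From \<open>n \<ge> \<delta> * cmod z\<close> the slope is at most
      \<open>1 / \<delta>\<close>; \<open>1 + 1 / \<delta>\<close> is a root-free upper bound for
      \<open>sqrt (1 + e\<^sup>2)\<close>.\<close>
    have "\<delta> * \<bar>Im z\<bar> \<le> \<delta> * cmod z" using delta abs_Im_le_cmod[of z] by (intro mult_left_mono) auto
    also have "\<dots> \<le> n" using complex_Re_le_cmod[of z] by (simp add: n_def algebra_simps)
    finally have "\<bar>e\<bar> \<le> 1 / \<delta>" using npos delta by (simp add: e_def abs_mult field_simps)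
    then have "\<bar>e\<bar>\<^sup>2 \<le> (1 / \<delta>)\<^sup>2" by (intro power_mono) auto
    moreover have "(1 + 1 / \<delta>)\<^sup>2 = 1 + 2 * (1 / \<delta>) + (1 / \<delta>)\<^sup>2" by (simp add: power2_eq_square algebra_simps)
    moreover have "0 < 1 / \<delta>" using delta by simp
    ultimately have "1 + e\<^sup>2 \<le> (1 + 1 / \<delta>)\<^sup>2" unfolding power2_abs by linarith
    from shear_dilatation[OF assms(2) c this assms(3)]
    show "\<kappa>\<^sup>2 * (1 + e\<^sup>2) * exp X \<le> (exp X - 1)\<^sup>2 * (1 + \<kappa>)" by simp
  qed
  ultimately have "cmod (u + \<i> * v) \<le> (exp X - 1) / (exp X + 1) * cmod (u - \<i> * v)"
    using mult_left_mono[of _ _ P] Ppos by (simp only: mult.left_commute less_imp_le)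
  then have "cmod ((u + \<i> * v) / 2) \<le> (exp X - 1) / (exp X + 1) * cmod ((u - \<i> * v) / 2)"
    by (simp only: norm_divide norm_numeral times_divide_eq_right) (rule divide_right_mono, simp_all)
  then show ?thesis
    unfolding dilatation_le_at_def complex_surj
    using U V by blast
qed

lemma open_focal: "open {z. focal z < c}" "open {z. c < focal z}"
  using continuous_focal by (auto intro!: open_Collect_less continuous_on_const)

lemma dilatation_full_step_reflect:
  assumes "dilatation_le_at K (full_step b b' G) (1 - z)"
  shows "dilatation_le_at K (full_step b b' G) z"
  using dilatation_le_at_affine[of K "full_step b b' G" "- 1" z 1 "- 1" 1] assms
  by (simp add: full_step_reflect)

lemma dilatation_full_step_inner:
  assumes "fixes_outside G" "0 < b" "b < rim" "0 < b'" "focal z < b"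
    and "dilatation_le_at K G (z / of_real b)"
  shows "dilatation_le_at K (full_step b b' G) z"
proof (rule dilatation_le_at_cong)
  show "dilatation_le_at K (\<lambda>w. of_real b' * G (w / of_real b)) z"
    using dilatation_le_at_affine[of K G "1 / b" z 0 "of_real b'" 0] assms(6) by simp
  have "eventually (\<lambda>w. w \<in> {w. focal w < b}) (nhds z)"
    using assms(5) by (intro eventually_nhds_in_open open_focal) auto
  then show "eventually (\<lambda>w. of_real b' * G (w / of_real b) = full_step b b' G w) (nhds z)"
    by eventually_elim (use assms in \<open>simp add: full_step_inner\<close>)
qed

text \<open>Away from the curves where the formula changes, a neighbourhood of \<open>z\<close> lies
  in a single zone. The inner zone merely inherits the bound for \<open>G\<close>, since rescaling
  is conformal.\<close>

lemma dilatation_full_step_left: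
  assumes G: "fixes_outside G" and b: "admissible b" "admissible b'" and s: "\<bar>ln (b' / b)\<bar> \<le> s"
    and z: "Re z < 1 / 2" "focal z \<noteq> b" "focal z \<noteq> rim"
    and inner: "focal z < b \<Longrightarrow> dilatation_le_at (exp (dil_const * s)) G (z / of_real b)"
  shows "dilatation_le_at (exp (dil_const * s)) (full_step b b' G) z"
proof -
  note bb = admissibleD[OF b(1)] admissibleD[OF b(2)]
  have K: "1 \<le> exp (dil_const * s)" using s dil_const_pos by simp
  consider "focal z < b" | "b < focal z" "focal z < rim" | "rim < focal z" using z by linarith
  then show ?thesis
  proof cases
    case 1
    then show ?thesis using dilatation_full_step_inner[OF G] bb inner by blast
  next
    case 2
    define \<kappa> where "\<kappa> = ln (b' / b) / ln (b / rim)"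
    have "(1 + 1 / \<delta>) * \<bar>ln (1 + \<kappa>)\<bar> \<le> (1 + 1 / \<delta>) * (2 / \<delta> * \<bar>ln (b' / b)\<bar>)"
      using radial_exponent(2)[OF b] delta unfolding \<kappa>_def by (intro mult_left_mono) auto
    also have "\<dots> = dil_const * \<bar>ln (b' / b)\<bar>" by (simp add: dil_const_def)
    also have "\<dots> \<le> dil_const * s" using s dil_const_pos by simp
    finally have le: "(1 + 1 / \<delta>) * \<bar>ln (1 + \<kappa>)\<bar> \<le> dil_const * s" .
    have "focal 0 = 0" by (simp add: focal_def)
    then have "z \<noteq> 0" using 2 bb by auto
    then have d: "dilatation_le_at (exp (dil_const * s)) (\<lambda>w. of_real ((focal w / rim) powr \<kappa>) * w) z"
      using dilatation_power_stretch le radial_exponent(1)[OF b] unfolding \<kappa>_def by blast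
    have "eventually (\<lambda>w. w \<in> {w. focal w < rim} \<inter> {w. b < focal w}) (nhds z)"
      using 2 by (intro eventually_nhds_in_open open_Int open_focal) auto
    then have "eventually (\<lambda>w. of_real ((focal w / rim) powr \<kappa>) * w = full_step b b' G w) (nhds z)"
      by eventually_elim (use G bb in \<open>simp add: full_step_ring radial_mid \<kappa>_def\<close>)
    then show ?thesis using dilatation_le_at_cong[OF d] by blast
  next
    case 3
    have "eventually (\<lambda>w. w \<in> {w. rim < focal w} \<inter> {w. Re w < 1 / 2}) (nhds z)"
      using 3 z by (intro eventually_nhds_in_open open_Int open_focal open_halfspace_Re_lt) auto
    then have "eventually (\<lambda>w. w = full_step b b' G w) (nhds z)"
      by eventually_elim (use G bb in \<open>simp add: full_step_outer\<close>)
    then show ?thesis using dilatation_le_at_cong[OF dilatation_le_at_ident[OF K]] by blast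
  qed
qed

text \<open>By homogeneity a ray from \<open>0\<close> meets a positive level at most once.\<close>

lemma AE_focal_neq:
  assumes "0 < c"
  shows "AE z in lborel. focal z \<noteq> c"
proof -
  have "negligible {z. focal z = c}"
  proof (rule starlike_negligible[of _ 0])
    show "closed {z. focal z = c}"
      using continuous_focal by (intro closed_Collect_eq continuous_on_const)
    fix t :: real and x assume "0 + t *\<^sub>R x \<in> {z. focal z = c}" "0 \<le> t" "0 + x \<in> {z. focal z = c}"
    then show "t = 1" using focal_scale[of t x] assms by (simp add: scaleR_conv_of_real)
  qed
  then show ?thesis by (simp add: AE_lborel_iff_negligible)
qed

lemma AE_scale:
  fixes P :: "complex \<Rightarrow> bool"
  assumes "AE z in lborel. P z" "b \<noteq> 0"
  shows "AE z in lborel. P (z / of_real b)"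
  using AE_lborel_affine[OF assms(1), of "1 / b" 0] assms(2) by simp

lemma AE_reflect:
  fixes P :: "complex \<Rightarrow> bool"
  assumes "AE z in lborel. P z"
  shows "AE z in lborel. P (1 - z)"
  using AE_lborel_affine[OF assms, of "- 1" 1] by simp

text \<open>The functional equation alone gives no starting point for an induction. Outside the
  region of depth \<open>k\<close>, unfolding it ends at the identity after at most \<open>k\<close>
  levels.\<close>

lemma AE_dilatation_outside:
  assumes "admissible_seq b" "admissible_seq b'" "\<And>n. \<bar>ln (b' n / b n)\<bar> \<le> s"
  shows "AE z in lborel. z \<notin> closed_region k b \<longrightarrow> dilatation_le_at (exp (dil_const * s)) (cantor_map b b') z"
  using assms
proof (induction k arbitrary: b b')
  case 0
  have "0 \<le> s" using 0(3)[of 0] abs_ge_zero order_trans by blast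
  then have K: "1 \<le> exp (dil_const * s)" using dil_const_pos by simp
  have "dilatation_le_at (exp (dil_const * s)) (cantor_map b b') z" if "1 < focal z" for z
  proof (rule dilatation_le_at_cong[OF dilatation_le_at_ident[OF K]])
    have "eventually (\<lambda>w. w \<in> {w. 1 < focal w}) (nhds z)"
      using that by (intro eventually_nhds_in_open open_focal) auto
    then show "eventually (\<lambda>w. w = cantor_map b b' w) (nhds z)"
      by eventually_elim (use fixes_outside_cantor_map[OF 0(1,2)] in \<open>simp add: fixes_outside_def\<close>)
  qed
  then show ?case by auto
next
  case (Suc k)
  let ?K = "exp (dil_const * s)" and ?G = "cantor_map (shift b) (shift b')"
  have adm: "admissible (b 0)" "admissible (b' 0)" using Suc.prems by (auto simp: admissible_seq_def)
  note bb = admissibleD[OF adm(1)] admissibleD[OF adm(2)]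
  have G: "fixes_outside ?G" by (intro fixes_outside_cantor_map admissible_seq_shift Suc.prems)
  have "AE z in lborel. z \<notin> closed_region k (shift b) \<longrightarrow> dilatation_le_at ?K ?G z"
    by (intro Suc.IH admissible_seq_shift Suc.prems(1,2)) (simp add: shift_def Suc.prems(3))
  then have ih: "AE z in lborel. z / of_real (b 0) \<notin> closed_region k (shift b) \<longrightarrow>
      dilatation_le_at ?K ?G (z / of_real (b 0))"
    by (rule AE_scale) (use bb in simp)
  \<comment> \<open>All that is asked of a point in the left half; a point in the right half uses
    the same condition at its mirror image.\<close>
  define Q where "Q z \<longleftrightarrow> focal z \<noteq> b 0 \<and> focal z \<noteq> rim \<and>
      (z / of_real (b 0) \<notin> closed_region k (shift b) \<longrightarrow> dilatation_le_at ?K ?G (z / of_real (b 0)))" for z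
  have Q: "AE z in lborel. Q z"
    unfolding Q_def using ih AE_focal_neq[OF bb(1)] AE_focal_neq[OF rim_bounds(1)] by eventually_elim auto
  have left: "dilatation_le_at ?K (cantor_map b b') z"
    if "Q z" "Re z < 1 / 2" "z / of_real (b 0) \<notin> closed_region k (shift b)" for z
    unfolding cantor_map_step[OF Suc.prems(1,2)]
    by (rule dilatation_full_step_left[OF G adm Suc.prems(3)]) (use that in \<open>auto simp: Q_def\<close>)
  show ?case using Q AE_reflect[OF Q] AE_Re_neq[of "1 / 2"]
  proof eventually_elim
    case (elim z)
    show ?case
    proof
      assume z: "z \<notin> closed_region (Suc k) b"
      show "dilatation_le_at ?K (cantor_map b b') z"
      proof (cases "Re z < 1 / 2")
        case True
        then show ?thesis using left elim z by simp
      next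
        case False
        then have "dilatation_le_at ?K (cantor_map b b') (1 - z)" using left[of "1 - z"] elim z by simp
        then show ?thesis
          unfolding cantor_map_step[OF Suc.prems(1,2)] by (rule dilatation_full_step_reflect)
      qed
    qed
  qed
qed

lemma AE_dilatation:
  assumes "admissible_seq b" "admissible_seq b'" "\<And>n. \<bar>ln (b' n / b n)\<bar> \<le> s"
  shows "AE z in lborel. dilatation_le_at (exp (dil_const * s)) (cantor_map b b') z"
proof -
  have "AE z in lborel. \<forall>k. z \<notin> closed_region k b \<longrightarrow> dilatation_le_at (exp (dil_const * s)) (cantor_map b b') z"
    unfolding AE_all_countable using AE_dilatation_outside[OF assms] by blast
  then show ?thesis using AE_Im_nonzero
    by eventually_elim (use eventually_outside_region[OF assms(1)] in blast)
qed

lemma open_region_focal_less_1: "admissible_seq b \<Longrightarrow> z \<in> open_region k b \<Longrightarrow> focal z < 1"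
proof (induction k arbitrary: b z)
  case (Suc k)
  note b = admissible_seqD[OF Suc.prems(1), of 0]
  have "focal (z / of_real (b 0)) < 1 \<or> focal ((1 - z) / of_real (b 0)) < 1"
    using Suc.prems Suc.IH[OF admissible_seq_shift[OF Suc.prems(1)]] by auto
  then have "focal z < 1 \<or> focal (1 - z) < 1"
    using b by (auto simp: focal_divide)
  then show ?case by (simp add: focal_reflect_less_1)
qed simp

text \<open>Inside the discs of depth \<open>k\<close> the map is, up to similarities on both sides,
  the limit map of the sequences shifted \<open>k\<close> times, so only ratios from index
  \<open>k\<close> on enter. Open discs let the inner formula hold in a neighbourhood.\<close>

lemma AE_dilatation_open_region:
  assumes "admissible_seq b" "admissible_seq b'" "\<And>n. k \<le> n \<Longrightarrow> \<bar>ln (b' n / b n)\<bar> \<le> s"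
  shows "AE z in lborel. z \<in> open_region k b \<longrightarrow> dilatation_le_at (exp (dil_const * s)) (cantor_map b b') z"
  using assms
proof (induction k arbitrary: b b')
  case 0
  then have "AE z in lborel. dilatation_le_at (exp (dil_const * s)) (cantor_map b b') z"
    by (intro AE_dilatation) auto
  then show ?case by eventually_elim simp
next
  case (Suc k)
  let ?K = "exp (dil_const * s)" and ?G = "cantor_map (shift b) (shift b')"
  note bb = admissible_seqD[OF Suc.prems(1), of 0] admissible_seqD[OF Suc.prems(2), of 0]
  have G: "fixes_outside ?G" by (intro fixes_outside_cantor_map admissible_seq_shift Suc.prems)
  define Q where "Q z \<longleftrightarrow> (z / of_real (b 0) \<in> open_region k (shift b) \<longrightarrow>
      dilatation_le_at ?K ?G (z / of_real (b 0)))" for z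
  have "AE z in lborel. z \<in> open_region k (shift b) \<longrightarrow> dilatation_le_at ?K ?G z"
    by (intro Suc.IH admissible_seq_shift Suc.prems(1,2)) (simp add: shift_def Suc.prems(3))
  then have Q: "AE z in lborel. Q z"
    unfolding Q_def by (rule AE_scale) (use bb in simp)
  have left: "dilatation_le_at ?K (cantor_map b b') z"
    if "Q z" "z / of_real (b 0) \<in> open_region k (shift b)" for z
    unfolding cantor_map_step[OF Suc.prems(1,2)]
  proof (rule dilatation_full_step_inner[OF G])
    have "focal (z / of_real (b 0)) < 1"
      using open_region_focal_less_1[OF admissible_seq_shift[OF Suc.prems(1)] that(2)] .
    then show "focal z < b 0" using bb by (simp add: focal_divide)
  qed (use that bb in \<open>auto simp: Q_def\<close>)
  show ?case using Q AE_reflect[OF Q]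
  proof eventually_elim
    case (elim z)
    show ?case
    proof
      assume "z \<in> open_region (Suc k) b"
      then consider "z / of_real (b 0) \<in> open_region k (shift b)" | "(1 - z) / of_real (b 0) \<in> open_region k (shift b)"
        by auto
      then show "dilatation_le_at ?K (cantor_map b b') z"
      proof cases
        case 1
        then show ?thesis using left elim by simp
      next
        case 2
        then have "dilatation_le_at ?K (cantor_map b b') (1 - z)" using left[of "1 - z"] elim by simp
        then show ?thesis
          unfolding cantor_map_step[OF Suc.prems(1,2)] by (rule dilatation_full_step_reflect)
      qed
    qed
  qed
qed

end

section \<open>Stages of the Cantor set\<close>

text \<open>One subdivision is isolated because it commutes with affine maps acting on both end
  points. A reflection must also swap them, hence its separate lemma.\<close>

definition interval_children :: "real \<Rightarrow> real \<times> real \<Rightarrow> (real \<times> real) set" where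
  "interval_children r p =
     {(fst p, (fst p + snd p)/2 - r * (snd p - fst p)/2), ((fst p + snd p)/2 + r * (snd p - fst p)/2, snd p)}"

lemma cantor_intervals_Suc:
  "cantor_intervals q (Suc k) = (\<Union>p\<in>cantor_intervals q k. interval_children (q (Suc k)) p)"
  by (simp add: interval_children_def case_prod_beta)

lemma interval_children_affine:
  "interval_children r (map_prod (\<lambda>x. m * x + d) (\<lambda>x. m * x + d) p) =
     map_prod (\<lambda>x. m * x + d) (\<lambda>x. m * x + d) ` interval_children r p"
  by (simp add: interval_children_def field_simps)

lemma interval_children_reflect:
  "interval_children r (1 - snd p, 1 - fst p) = (\<lambda>p. (1 - snd p, 1 - fst p)) ` interval_children r p"
  by (simp add: interval_children_def field_simps insert_commute)

text \<open>The definition subdivides at the last level, the plane map at the first; affine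
  covariance exchanges the two orders. The summand \<open>+ 0\<close> gives both branches the shape
  required by \<open>interval_children_affine\<close>.\<close>

lemma cantor_intervals_affine:
  defines "\<beta> \<equiv> \<lambda>q :: nat \<Rightarrow> real. (1 - q 1) / 2"
  shows "cantor_intervals q (Suc k) =
    map_prod (\<lambda>x. \<beta> q * x + 0) (\<lambda>x. \<beta> q * x + 0) ` cantor_intervals (\<lambda>n. q (Suc n)) k \<union>
    map_prod (\<lambda>x. \<beta> q * x + (1 - \<beta> q)) (\<lambda>x. \<beta> q * x + (1 - \<beta> q)) ` cantor_intervals (\<lambda>n. q (Suc n)) k"
proof (induction k)
  case 0
  show ?case by (auto simp: \<beta>_def diff_divide_distrib add_divide_distrib)
next
  case (Suc k)
  show ?case
    by (subst cantor_intervals_Suc, subst Suc.IH)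
       (simp add: cantor_intervals_Suc interval_children_affine image_UN UN_Un del: cantor_intervals.simps(2) add_0_right)
qed

lemma cantor_intervals_reflect:
  "p \<in> cantor_intervals q k \<Longrightarrow> (1 - snd p, 1 - fst p) \<in> cantor_intervals q k"
proof (induction k arbitrary: p)
  case (Suc k)
  then obtain p' where p': "p' \<in> cantor_intervals q k" "p \<in> interval_children (q (Suc k)) p'"
    unfolding cantor_intervals_Suc by blast
  then have "(1 - snd p, 1 - fst p) \<in> interval_children (q (Suc k)) (1 - snd p', 1 - fst p')"
    unfolding interval_children_reflect by blast
  then show ?case using Suc.IH[OF p'(1)] unfolding cantor_intervals_Suc by blast
qed simp

lemma cantor_stage_iff: "x \<in> cantor_stage q k \<longleftrightarrow> (\<exists>p\<in>cantor_intervals q k. fst p \<le> x \<and> x \<le> snd p)"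
  by (auto simp: cantor_stage_def case_prod_beta)

lemma cantor_stage_reflect:
  assumes "x \<in> cantor_stage q k"
  shows "1 - x \<in> cantor_stage q k"
proof -
  obtain p where "p \<in> cantor_intervals q k" "fst p \<le> x" "x \<le> snd p"
    using assms unfolding cantor_stage_iff by blast
  then show ?thesis
    unfolding cantor_stage_iff using cantor_intervals_reflect[of p q k]
    by (intro bexI[of _ "(1 - snd p, 1 - fst p)"]) auto
qed

text \<open>The right child arises as a translate, whereas the regions and the plane map use a
  reflected copy; the symmetry of the stages reconciles the two.\<close>

lemma cantor_stage_Suc:
  assumes "q 1 < 1"
  defines "\<beta> \<equiv> (1 - q 1) / 2"
  shows "x \<in> cantor_stage q (Suc k) \<longleftrightarrow>
    x / \<beta> \<in> cantor_stage (\<lambda>n. q (Suc n)) k \<or> (1 - x) / \<beta> \<in> cantor_stage (\<lambda>n. q (Suc n)) k"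
proof -
  have \<beta>: "0 < \<beta>" using assms by simp
  let ?I = "cantor_intervals (\<lambda>n. q (Suc n)) k"
  have "x \<in> cantor_stage q (Suc k) \<longleftrightarrow>
      (\<exists>p\<in>?I. \<beta> * fst p \<le> x \<and> x \<le> \<beta> * snd p) \<or>
      (\<exists>p\<in>?I. \<beta> * fst p + (1 - \<beta>) \<le> x \<and> x \<le> \<beta> * snd p + (1 - \<beta>))"
    unfolding cantor_stage_iff cantor_intervals_affine \<beta>_def by (simp only: bex_Un bex_simps fst_map_prod snd_map_prod) simp
  also have "\<dots> \<longleftrightarrow> (\<exists>p\<in>?I. fst p \<le> x / \<beta> \<and> x / \<beta> \<le> snd p) \<or>
      (\<exists>p\<in>?I. fst p \<le> 1 - (1 - x) / \<beta> \<and> 1 - (1 - x) / \<beta> \<le> snd p)"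
  proof -
    have "\<beta> * t \<le> x \<longleftrightarrow> t \<le> x / \<beta>" "x \<le> \<beta> * t \<longleftrightarrow> x / \<beta> \<le> t"
      "\<beta> * t + (1 - \<beta>) \<le> x \<longleftrightarrow> t \<le> 1 - (1 - x) / \<beta>" "x \<le> \<beta> * t + (1 - \<beta>) \<longleftrightarrow> 1 - (1 - x) / \<beta> \<le> t" for t
      using \<beta> by (auto simp: field_simps)
    then show ?thesis by simp
  qed
  also have "\<dots> \<longleftrightarrow> x / \<beta> \<in> cantor_stage (\<lambda>n. q (Suc n)) k \<or> 1 - (1 - x) / \<beta> \<in> cantor_stage (\<lambda>n. q (Suc n)) k"
    by (simp only: cantor_stage_iff)
  also have "1 - (1 - x) / \<beta> \<in> cantor_stage (\<lambda>n. q (Suc n)) k \<longleftrightarrow> (1 - x) / \<beta> \<in> cantor_stage (\<lambda>n. q (Suc n)) k"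
    using cantor_stage_reflect[of "(1 - x) / \<beta>"] cantor_stage_reflect[of "1 - (1 - x) / \<beta>"] by fastforce
  finally show ?thesis .
qed

lemma ratio_seq_shift: "ratio_seq \<delta> q \<Longrightarrow> ratio_seq \<delta> (\<lambda>n. q (Suc n))"
  by (simp add: ratio_seq_def)

section \<open>The image of the Cantor set\<close>

context thick
begin

text \<open>The index moves by one: the ratios start at \<open>1\<close>, the sequences of the plane
  construction at \<open>0\<close>.\<close>

definition contraction :: "(nat \<Rightarrow> real) \<Rightarrow> nat \<Rightarrow> real" where
  "contraction q n = (1 - q (Suc n)) / 2"

lemma shift_contraction: "shift (contraction q) = contraction (\<lambda>n. q (Suc n))"
  by (simp add: shift_def contraction_def fun_eq_iff)

lemma admissible_contraction: "ratio_seq \<delta> q \<Longrightarrow> admissible_seq (contraction q)"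
  by (auto simp: admissible_seq_def admissible_def contraction_def ratio_seq_def)

lemma cantor_stage_contraction:
  assumes "ratio_seq \<delta> q"
  shows "x \<in> cantor_stage q (Suc k) \<longleftrightarrow>
    x / contraction q 0 \<in> cantor_stage (\<lambda>n. q (Suc n)) k \<or> (1 - x) / contraction q 0 \<in> cantor_stage (\<lambda>n. q (Suc n)) k"
proof -
  have "q 1 < 1" using assms by (simp add: ratio_seq_def)
  then show ?thesis using cantor_stage_Suc[of q x k] by (simp add: contraction_def)
qed

lemma cantor_stage_unit: "ratio_seq \<delta> q \<Longrightarrow> x \<in> cantor_stage q k \<Longrightarrow> 0 \<le> x \<and> x \<le> 1"
proof (induction k arbitrary: q x)
  case 0
  then show ?case by (simp add: cantor_stage_def)
next
  case (Suc k)
  note b = admissible_seqD[OF admissible_contraction[OF Suc.prems(1)], of 0]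
  have "(0 \<le> x / contraction q 0 \<and> x / contraction q 0 \<le> 1) \<or>
      (0 \<le> (1 - x) / contraction q 0 \<and> (1 - x) / contraction q 0 \<le> 1)"
    using Suc.prems(2) Suc.IH[OF ratio_seq_shift[OF Suc.prems(1)]]
    unfolding cantor_stage_contraction[OF Suc.prems(1)] by blast
  then have "(0 \<le> x \<and> x \<le> contraction q 0) \<or> (0 \<le> 1 - x \<and> 1 - x \<le> contraction q 0)"
    using b(1) by (simp add: zero_le_divide_iff)
  then show ?case using b by linarith
qed

lemma cantor_stage_open_region:
  "ratio_seq \<delta> q \<Longrightarrow> x \<in> cantor_stage q k \<Longrightarrow> complex_of_real x \<in> open_region k (contraction q)"
proof (induction k arbitrary: q x)
  case 0
  then show ?case using cantor_stage_unit[OF 0] delta by (simp add: focal_of_real)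
next
  case (Suc k)
  have "complex_of_real (x / contraction q 0) \<in> open_region k (shift (contraction q)) \<or>
      complex_of_real ((1 - x) / contraction q 0) \<in> open_region k (shift (contraction q))"
    using Suc.prems(2) Suc.IH[OF ratio_seq_shift[OF Suc.prems(1)]]
    unfolding cantor_stage_contraction[OF Suc.prems(1)] shift_contraction by blast
  then show ?case by simp
qed

lemma approx_Reals:
  assumes "z \<in> \<real>"
  shows "approx k b b' z \<in> \<real>"
  using assms
proof (induction k arbitrary: b b' z)
  case (Suc k)
  then show ?case unfolding approx.simps full_step_def half_step_def
    by (intro Reals_diff Reals_add Reals_mult Reals_divide Suc.IH Reals_of_real Reals_1)
qed simp

text \<open>Positivity combined with the reflection \<open>x \<mapsto> 1 - x\<close> will keep
  \<open>[0, 1]\<close> invariant.\<close>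

lemma approx_nonneg_Reals:
  assumes "admissible_seq b" "admissible_seq b'" "z \<in> \<real>\<^sub>\<ge>\<^sub>0"
  shows "approx k b b' z \<in> \<real>\<^sub>\<ge>\<^sub>0"
  using assms
proof (induction k arbitrary: b b' z)
  case (Suc k)
  let ?G = "approx k (shift b) (shift b')"
  note b = admissible_seqD[OF Suc.prems(1), of 0] admissible_seqD[OF Suc.prems(2), of 0]
  have G: "fixes_outside ?G" by (intro fixes_outside_approx admissible_seq_shift Suc.prems)
  have G1: "focal w \<le> 1 \<Longrightarrow> focal (?G w) \<le> 1" for w
    by (intro approx_focal_le_1 admissible_seq_shift Suc.prems)
  show ?case
  proof (cases "Re z \<le> 1 / 2")
    case True
    consider "rim \<le> focal z" | "b 0 \<le> focal z" "focal z \<le> rim" | "focal z \<le> b 0" by linarith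
    then show ?thesis
    proof cases
      case 1
      then show ?thesis using G b True Suc.prems(3) by (simp add: full_step_outer)
    next
      case 2
      then show ?thesis using G b Suc.prems(3) radial_pos[OF b(1)]
        by (simp add: full_step_ring nonneg_Reals_mult_I less_imp_le)
    next
      case 3
      have "?G (z / of_real (b 0)) \<in> \<real>\<^sub>\<ge>\<^sub>0"
        using Suc.prems b by (intro Suc.IH admissible_seq_shift) (auto simp: complex_nonneg_Reals_iff)
      then show ?thesis using G b 3 by (simp add: full_step_inner nonneg_Reals_mult_I)
    qed
  next
    case False
    \<comment> \<open>The image of \<open>z\<close> is \<open>1 - ?w\<close>, and \<open>?w\<close>
      is real and at most \<open>1 / 2\<close>, even if it is negative.\<close>
    let ?w = "full_step (b 0) (b' 0) ?G (1 - z)"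
    have "Re ?w \<le> 1 / 2"
    proof (cases "rim \<le> focal (1 - z)")
      case True
      then show ?thesis using G b False by (simp add: full_step_outer)
    next
      case 2: False
      then show ?thesis using full_step_focal_le_rim[OF G G1, of "b 0" "b' 0" "1 - z"] b
        by (intro Re_le_half) auto
    qed
    moreover have "Im ?w = 0"
      using approx_Reals[of "1 - z" "Suc k" b b'] Suc.prems(3)
      by (simp add: complex_is_Real_iff complex_nonneg_Reals_iff)
    moreover have "approx (Suc k) b b' z = 1 - ?w" by (simp add: full_step_reflect)
    ultimately show ?thesis by (simp add: complex_nonneg_Reals_iff)
  qed
qed simp

lemma cantor_map_reflect:
  assumes "admissible_seq b" "admissible_seq b'"
  shows "cantor_map b b' (1 - z) = 1 - cantor_map b b' z"
  unfolding cantor_map_step[OF assms] by (rule full_step_reflect)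

lemma cantor_map_nonneg_Reals:
  assumes "admissible_seq b" "admissible_seq b'" "z \<in> \<real>\<^sub>\<ge>\<^sub>0"
  shows "cantor_map b b' z \<in> \<real>\<^sub>\<ge>\<^sub>0"
  by (rule closed_sequentially[OF closed_nonneg_Reals_complex approx_nonneg_Reals[OF assms] cantor_map_limit[OF assms(1,2)]])

lemma cantor_map_unit:
  assumes "admissible_seq b" "admissible_seq b'" "0 \<le> x" "x \<le> 1"
  obtains y where "cantor_map b b' (of_real x) = of_real y" "0 \<le> y" "y \<le> 1"
proof -
  have "cantor_map b b' (of_real x) \<in> \<real>\<^sub>\<ge>\<^sub>0"
    using assms by (intro cantor_map_nonneg_Reals) auto
  moreover have "cantor_map b b' (of_real (1 - x)) \<in> \<real>\<^sub>\<ge>\<^sub>0"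
    using assms by (intro cantor_map_nonneg_Reals) (auto simp del: of_real_diff)
  then have "1 - cantor_map b b' (of_real x) \<in> \<real>\<^sub>\<ge>\<^sub>0"
    using cantor_map_reflect[OF assms(1,2), of "of_real x"] by simp
  ultimately show ?thesis
    by (intro that[of "Re (cantor_map b b' (of_real x))"]) (auto simp: complex_nonneg_Reals_iff complex_eq_iff)
qed

text \<open>On the left child the map is a rescaled copy of the map of the shifted sequences, so
  induction applies; the right child follows by symmetry.\<close>

lemma cantor_map_stage:
  assumes "ratio_seq \<delta> q" "ratio_seq \<delta> q'" "x \<in> cantor_stage q k"
  shows "\<exists>y\<in>cantor_stage q' k. cantor_map (contraction q) (contraction q') (of_real x) = of_real y"
  using assms
proof (induction k arbitrary: q q' x)
  case 0
  then have x: "0 \<le> x" "x \<le> 1" using cantor_stage_unit by blast+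
  obtain y where "cantor_map (contraction q) (contraction q') (of_real x) = of_real y" "0 \<le> y" "y \<le> 1"
    using cantor_map_unit[OF admissible_contraction[OF 0(1)] admissible_contraction[OF 0(2)] x] .
  then show ?case by (auto simp: cantor_stage_def)
next
  case (Suc k)
  note adm = admissible_contraction[OF Suc.prems(1)] admissible_contraction[OF Suc.prems(2)]
  note b = admissible_seqD[OF adm(1), of 0] admissible_seqD[OF adm(2), of 0]
  let ?F = "cantor_map (contraction q) (contraction q')"
    and ?G = "cantor_map (shift (contraction q)) (shift (contraction q'))"
  have G: "fixes_outside ?G" by (intro fixes_outside_cantor_map admissible_seq_shift adm)
  have left: "\<exists>y\<in>cantor_stage q' (Suc k). ?F (of_real x) = of_real y"
    if x: "x / contraction q 0 \<in> cantor_stage (\<lambda>n. q (Suc n)) k" for x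
  proof -
    have u: "0 \<le> x / contraction q 0 \<and> x / contraction q 0 \<le> 1"
      by (rule cantor_stage_unit[OF ratio_seq_shift[OF Suc.prems(1)] x])
    then have "0 \<le> x" "x \<le> contraction q 0" using b by (auto simp: field_simps)
    moreover have "2 * x / (2 + \<delta>) \<le> x" using delta \<open>0 \<le> x\<close> by (simp add: field_simps)
    ultimately have "focal (of_real x) \<le> contraction q 0" by (simp add: focal_of_real)
    then have eq: "?F (of_real x) = of_real (contraction q' 0) * ?G (of_real (x / contraction q 0))"
      unfolding cantor_map_step[OF adm] using G b by (simp add: full_step_inner)
    obtain y where y: "y \<in> cantor_stage (\<lambda>n. q' (Suc n)) k" "?G (of_real (x / contraction q 0)) = of_real y"
      using Suc.IH[OF ratio_seq_shift[OF Suc.prems(1)] ratio_seq_shift[OF Suc.prems(2)] x]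
      unfolding shift_contraction by blast
    have "contraction q' 0 * y \<in> cantor_stage q' (Suc k)"
      unfolding cantor_stage_contraction[OF Suc.prems(2)] using y(1) b by simp
    moreover have "?F (of_real x) = of_real (contraction q' 0 * y)" unfolding eq y(2) by simp
    ultimately show ?thesis by blast
  qed
  show ?case
  proof (cases "x / contraction q 0 \<in> cantor_stage (\<lambda>n. q (Suc n)) k")
    case True
    then show ?thesis by (rule left)
  next
    case False
    then have "(1 - x) / contraction q 0 \<in> cantor_stage (\<lambda>n. q (Suc n)) k"
      using Suc.prems(3) unfolding cantor_stage_contraction[OF Suc.prems(1)] by blast
    from left[OF this] obtain y where "y \<in> cantor_stage q' (Suc k)" "?F (of_real (1 - x)) = of_real y" by blast
    then have "1 - y \<in> cantor_stage q' (Suc k)" "?F (of_real x) = of_real (1 - y)"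
      using cantor_stage_reflect cantor_map_reflect[OF adm, of "of_real x"] by (auto simp: algebra_simps)
    then show ?thesis by blast
  qed
qed

lemma cantor_map_cantor_set:
  assumes "ratio_seq \<delta> q" "ratio_seq \<delta> q'" "x \<in> cantor_set q"
  shows "\<exists>y\<in>cantor_set q'. cantor_map (contraction q) (contraction q') (of_real x) = of_real y"
proof -
  have x: "x \<in> cantor_stage q k" if "1 \<le> k" for k
    using assms(3) that by (auto simp: cantor_set_def)
  obtain y where y: "cantor_map (contraction q) (contraction q') (of_real x) = of_real y"
    using cantor_map_stage[OF assms(1,2) x[OF order_refl]] by blast
  have "y \<in> cantor_stage q' k" if "1 \<le> k" for k
    using cantor_map_stage[OF assms(1,2) x[OF that]] y by auto
  then show ?thesis using y by (auto simp: cantor_set_def)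
qed

text \<open>Surjectivity is the forward inclusion for the exchanged sequences, transported by the
  inverse map.\<close>

lemma map_option_sphere_cantor_set:
  assumes "ratio_seq \<delta> q" "ratio_seq \<delta> q'"
  shows "map_option (cantor_map (contraction q) (contraction q')) ` sphere_cantor_set q = sphere_cantor_set q'"
proof (intro equalityI subsetI)
  fix w assume "w \<in> map_option (cantor_map (contraction q) (contraction q')) ` sphere_cantor_set q"
  then obtain x where x: "x \<in> cantor_set q" "w = Some (cantor_map (contraction q) (contraction q') (of_real x))"
    by (auto simp: sphere_cantor_set_def)
  then show "w \<in> sphere_cantor_set q'"
    using cantor_map_cantor_set[OF assms x(1)] by (auto simp: sphere_cantor_set_def)
next
  fix w assume "w \<in> sphere_cantor_set q'"
  then obtain y where y: "y \<in> cantor_set q'" "w = Some (of_real y)" by (auto simp: sphere_cantor_set_def)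
  then obtain x where x: "x \<in> cantor_set q" "cantor_map (contraction q') (contraction q) (of_real y) = of_real x"
    using cantor_map_cantor_set[OF assms(2,1)] by blast
  have "cantor_map (contraction q) (contraction q') (of_real x) = of_real y"
    unfolding x(2)[symmetric] by (rule cantor_map_inverse) (intro admissible_contraction assms)+
  then have "w = map_option (cantor_map (contraction q) (contraction q')) (Some (of_real x))" using y by simp
  moreover have "Some (complex_of_real x) \<in> sphere_cantor_set q" using x(1) by (auto simp: sphere_cantor_set_def)
  ultimately show "w \<in> map_option (cantor_map (contraction q) (contraction q')) ` sphere_cantor_set q" by blast
qed

section \<open>Passage to the sphere and the final estimates\<close>

lemma quasiconformal_on_cantor_map:
  assumes "admissible_seq b" "admissible_seq b'" "1 \<le> K" "openin riemann_sphere U"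
    and "AE z in lborel. Some z \<in> U \<longrightarrow> dilatation_le_at K (cantor_map b b') z"
  shows "quasiconformal_on K U (map_option (cantor_map b b'))"
\<comment> \<open>By \<open>norm_le_focal\<close> the elliptic disc of level \<open>1\<close> lies
  in the disc of this radius \<open>R\<close>.\<close>
proof (rule quasiconformal_on_map_option[where g = "cantor_map b' b" and R = "(2 + \<delta>) / 2"])
  fix z assume "cmod z > (2 + \<delta>) / 2"
  then have "(2 + \<delta>) / 2 * 1 < (2 + \<delta>) / 2 * focal z" using norm_le_focal[of z] by simp
  moreover have "0 < (2 + \<delta>) / 2" using delta by simp
  ultimately have "1 \<le> focal z" using mult_less_cancel_left_pos[of "(2 + \<delta>) / 2" 1 "focal z"] by linarith
  then show "cantor_map b b' z = z"
    using fixes_outside_cantor_map[OF assms(1,2)] by (simp add: fixes_outside_def)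
qed (use assms in \<open>auto intro!: continuous_cantor_map cantor_map_inverse ACL_on_cantor_map\<close>)

lemma openin_riemann_sphere_UNIV: "openin riemann_sphere UNIV"
proof -
  have "topspace riemann_sphere = UNIV" by (auto simp: image_iff)
  then show ?thesis by (metis openin_topspace)
qed

lemma quasiconformal_sphere_cantor_map:
  assumes "admissible_seq b" "admissible_seq b'" "\<And>n. \<bar>ln (b' n / b n)\<bar> \<le> s"
  shows "quasiconformal_sphere (exp (dil_const * s)) (map_option (cantor_map b b'))"
proof -
  have "0 \<le> s" using assms(3)[of 0] abs_ge_zero order_trans by blast
  then have "1 \<le> exp (dil_const * s)" using dil_const_pos by simp
  moreover have "AE z in lborel. Some z \<in> UNIV \<longrightarrow> dilatation_le_at (exp (dil_const * s)) (cantor_map b b') z"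
    using AE_dilatation[OF assms] by eventually_elim simp
  ultimately show ?thesis
    unfolding quasiconformal_sphere_def
    using assms(1,2) openin_riemann_sphere_UNIV
    by (intro conjI quasiconformal_on_cantor_map homeomorphic_map_riemann_sphere_map_option[of _ "cantor_map b' b"]
        continuous_cantor_map cantor_map_inverse)
qed

lemma contraction_quotient:
  "contraction q' n / contraction q n = (1 - q' (Suc n)) / (1 - q (Suc n))"
proof -
  have "(x / 2) / (y / 2) = x / y" for x y :: real by simp
  then show ?thesis unfolding contraction_def .
qed

lemma ln_contraction_le_ratio_dist:
  assumes "ratio_dist q q' < \<infinity>"
  shows "\<bar>ln (contraction q' n / contraction q n)\<bar> \<le> real_of_ereal (ratio_dist q q')"
proof -
  have "ereal (max \<bar>ln ((1 - q' (Suc n)) / (1 - q (Suc n)))\<bar> \<bar>q' (Suc n) - q (Suc n)\<bar>) \<le> ratio_dist q q'"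
    unfolding ratio_dist_def by (rule SUP_upper) simp
  then have "ereal \<bar>ln ((1 - q' (Suc n)) / (1 - q (Suc n)))\<bar> \<le> ratio_dist q q'"
    by (rule order_trans[rotated]) simp
  then show ?thesis
    using assms by (cases "ratio_dist q q'") (auto simp: contraction_quotient)
qed

lemma asymptotically_conformal_cantor_sets:
  assumes q: "ratio_seq \<delta> q" "ratio_seq \<delta> q'"
    and lim: "(\<lambda>n. ln ((1 - q' n) / (1 - q n))) \<longlonglongrightarrow> 0"
  shows "asymptotically_conformal_to (sphere_cantor_set q') (sphere_cantor_set q)"
proof -
  let ?b = "contraction q" and ?b' = "contraction q'"
  note adm = admissible_contraction[OF q(1)] admissible_contraction[OF q(2)]
  have lim': "(\<lambda>n. ln (?b' n / ?b n)) \<longlonglongrightarrow> 0"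
    unfolding contraction_quotient using LIMSEQ_Suc[OF lim] .
  obtain s where "\<And>n. \<bar>ln (?b' n / ?b n)\<bar> \<le> s"
    using BseqE[OF convergent_imp_Bseq[OF convergentI[OF lim']]] by (metis real_norm_def)
  from quasiconformal_sphere_cantor_map[OF adm this]
  have qc: "quasiconformal_sphere (exp (dil_const * s)) (map_option (cantor_map ?b ?b'))" .
  have "\<exists>U. openin riemann_sphere U \<and> sphere_cantor_set q \<subseteq> U \<and>
      quasiconformal_on (1 + \<epsilon>) U (map_option (cantor_map ?b ?b'))" if "\<epsilon> > 0" for \<epsilon>
  proof -
    \<comment> \<open>Chosen so that the dilatation bound \<open>exp (dil_const * t)\<close> is
      exactly \<open>1 + \<epsilon>\<close>.\<close>
    define t where "t = ln (1 + \<epsilon>) / dil_const"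
    have t: "0 < t" "exp (dil_const * t) = 1 + \<epsilon>" using that dil_const_pos by (auto simp: t_def)
    obtain N where N: "\<And>n. N \<le> n \<Longrightarrow> \<bar>ln (?b' n / ?b n)\<bar> \<le> t"
    proof -
      obtain N where "\<forall>n\<ge>N. norm (ln (?b' n / ?b n) - 0) < t" using LIMSEQ_D[OF lim' t(1)] by blast
      then show thesis by (intro that[of N]) (auto simp: less_imp_le)
    qed
    \<comment> \<open>The intersection defining \<open>cantor_set\<close> starts at stage
      \<open>1\<close>, so a positive depth is taken: \<open>Suc N\<close>.\<close>
    let ?U = "Some ` open_region (Suc N) ?b"
    have opn: "openin riemann_sphere ?U" using open_open_region[OF adm(1)] by (simp del: region.simps)
    have sub: "sphere_cantor_set q \<subseteq> ?U"
      using cantor_stage_open_region[OF q(1), of _ "Suc N"]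
      by (auto simp: sphere_cantor_set_def cantor_set_def simp del: region.simps)
    have "AE z in lborel. z \<in> open_region (Suc N) ?b \<longrightarrow>
        dilatation_le_at (exp (dil_const * t)) (cantor_map ?b ?b') z"
      by (rule AE_dilatation_open_region[OF adm]) (simp add: N)
    then have ae: "AE z in lborel. Some z \<in> ?U \<longrightarrow> dilatation_le_at (1 + \<epsilon>) (cantor_map ?b ?b') z"
      unfolding t(2) by eventually_elim auto
    have "quasiconformal_on (1 + \<epsilon>) ?U (map_option (cantor_map ?b ?b'))"
      using that by (intro quasiconformal_on_cantor_map[OF adm _ opn ae]) simp
    then show ?thesis using opn sub by blast
  qed
  then show ?thesis
    unfolding asymptotically_conformal_to_def
    using qc map_option_sphere_cantor_set[OF q] by blast
qed

end

theorem theorem2: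
  shows "\<exists>C :: real \<Rightarrow> real. \<forall>\<delta>>0. 0 < C \<delta> \<and>
    (\<forall>q q' :: nat \<Rightarrow> real. ratio_seq \<delta> q \<longrightarrow> ratio_seq \<delta> q' \<longrightarrow>
      (ratio_dist q q' < \<infinity> \<longrightarrow>
        (\<exists>\<phi>. quasiconformal_sphere (exp (C \<delta> * real_of_ereal (ratio_dist q q'))) \<phi> \<and>
             \<phi> ` sphere_cantor_set q = sphere_cantor_set q')) \<and>
      ((\<lambda>n. ln ((1 - q' n) / (1 - q n))) \<longlonglongrightarrow> 0 \<longrightarrow>
        asymptotically_conformal_to (sphere_cantor_set q') (sphere_cantor_set q)))"
proof (rule exI[of _ "\<lambda>\<delta>. 2 / \<delta> * (1 + 1 / \<delta>)"], intro allI impI conjI)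
  let ?C = "\<lambda>\<delta> :: real. 2 / \<delta> * (1 + 1 / \<delta>)"
  fix \<delta> :: real assume \<delta>: "0 < \<delta>"
  then show "0 < ?C \<delta>" by (simp add: add_pos_pos)
  fix q q' :: "nat \<Rightarrow> real" assume q: "ratio_seq \<delta> q" "ratio_seq \<delta> q'"
  \<comment> \<open>The existence of a ratio sequence forces \<open>\<delta> < 1\<close>, as the
    locale demands; for larger \<open>\<delta>\<close> the claim is vacuous.\<close>
  then have "\<delta> \<le> q 1" "q 1 < 1" by (simp_all add: ratio_seq_def)
  then interpret thick \<delta> using \<delta> by unfold_locales auto
  note adm = admissible_contraction[OF q(1)] admissible_contraction[OF q(2)]
  show "\<exists>\<phi>. quasiconformal_sphere (exp (?C \<delta> * real_of_ereal (ratio_dist q q'))) \<phi> \<and>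
      \<phi> ` sphere_cantor_set q = sphere_cantor_set q'" if "ratio_dist q q' < \<infinity>"
    using quasiconformal_sphere_cantor_map[OF adm ln_contraction_le_ratio_dist[OF that]]
      map_option_sphere_cantor_set[OF q] unfolding dil_const_def by blast
  show "asymptotically_conformal_to (sphere_cantor_set q') (sphere_cantor_set q)"
    if "(\<lambda>n. ln ((1 - q' n) / (1 - q n))) \<longlonglongrightarrow> 0"
    using asymptotically_conformal_cantor_sets[OF q that] .
qed

end
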